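(* Let $A$ be an Archimedean infinitesimal-free proper $*$-ring, let $(S,E)$ be a Weyl $*$-semigroup where $S$ is a $*$-subsemigroup of $A$ lying in the unit ball $A^1=\{a\in A:\|a\|\le1\}$, and let $L$ be an $S$-hereditary commutative $*$-subring of $A$ which is a lattice with respect to $\leqslant$. Assume that \[L_+=L_\Sigma/\mathbb{N}\quad\text{or}\quad\bigl(A\text{ is unital and }(A_+A_+)_{\mathrm{sa}}\subseteq A_+\bigr).\] Then the Weyl groupoid $\mathcal{U}(S)$ is locally compact.
   Context: A $*$-ring is an associative, not necessarily unital, ring $A$ with an additive map $a\mapsto a^*$ satisfying $a^{**}=a$, $(ab)^*=b^*a^*$. $\mathbb{N}$ denotes the positive integers. For $B\subseteq A$: $|B|^2=\{b^*b:b\in B\}$; $B_\Sigma=\{p_1+\cdots+p_k:k\ge1,\ p_i\in|B|^2\}$; $B/\mathbb{N}=\{a\in A:\exists n\in\mathbb{N}\ (na\in B)\}$; $B_{\mathrm{sa}}=\{b\in B:b=b^*\}$; $BB=\{bc:b,c\in B\}$. For $a\in A$, with $\inf\emptyset=\infty$ and $\vee$ denoting maximum of extended reals, \[\lceil a\rceil=\sup_{b\in A}\inf\{m/n:m,n\in\mathbb{N},\ mbb^*-nbab^*\in A_\Sigma\}\in[0,\infty],\qquad\|a\|=\sqrt{\lceil aa^*\rceil\vee\lceil a^*a\rceil}.\] $A$ is Archimedean if $\lceil-a\rceil=0$ implies $\lceil a\rceil<\infty$; infinitesimal-free if $\lceil a\rceil=\lceil-a\rceil=0$ implies $a=0$;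 proper if $aa^*=0$ implies $a=0$ (for all $a\in A$). Then $a\leqslant b\Leftrightarrow\lceil a-b\rceil=0$ defines a partial order on $A$; for $B\subseteq A$, $B_+=\{b\in B:0\leqslant b\}$. An additive subgroup $L$ of $A$ is $S$-hereditary if $|S|^2\subseteq L$ and every $a\in L_+$ with $a\leqslant s^*s$ for some $s\in S$ belongs to $S$. $(S,E)$ being a Weyl $*$-semigroup means $E\subseteq S$ satisfies $EE\subseteq E=E^*$, $a^*Ea\subseteq E$ for all $a\in S$, and for every $a\in S$ the element $a^*a$ lies in $E$ and commutes with every element of $E$. For $a,b\in S$: $a\precsim b$ iff $ab^*\in E$ and $a=ab^*b$. A filter is a non-empty $U\subseteq S$ such that for all $a,b\in S$: $a,b\in U$ iff there is $c\in U$ with $c\precsim a$ and $c\precsim b$. An ultrafilter is a filter $U\neq S$ maximal among filters different from $S$. The Weyl groupoid $\mathcal{U}(S)$ is the set of ultrafilters with the topology having basis $\mathcal{U}_a=\{U\in\mathcal{U}(S):a\in U\}$, $a\in S$ (its groupoid structure, with inverse $U\mapsto U^*$ and product $(U,V)\mapsto\{a\in S:\exists u\in U,v\in V\ (uv\precsim a)\}$, plays no role in the claim). Locally compact means every point has a neighbourhood base of compact sets ($\mathcal{U}(S)$ need not be Hausdorff). *)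

theory Defs
  imports "HOL-Analysis.Analysis" "HOL-Algebra.Lattice"
begin

section \<open>Star-rings\<close>

text \<open>The class \<^class>\<open>ring\<close> is associative and does not require a unit.\<close>

class star_ring = ring +
  fixes star :: "'a \<Rightarrow> 'a"
  assumes star_add: "star (a + b) = star a + star b"
    and star_star: "star (star a) = a"
    and star_mult: "star (a * b) = star b * star a"

text \<open>\<open>nmul n a\<close> is the multiple \<open>n a = a + \<dots> + a\<close>; \<open>of_nat n * a\<close> would need a unit.\<close>

definition nmul :: "nat \<Rightarrow> 'a::star_ring \<Rightarrow> 'a" where
  "nmul n a = (\<Sum>i<n. a)"

definition squares :: "'a::star_ring set \<Rightarrow> 'a set" where
  "squares B = {star b * b | b. b \<in> B}"

definition Sigma_sums :: "'a::star_ring set \<Rightarrow> 'a set" where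
  "Sigma_sums B = {sum_list ps | ps. ps \<noteq> [] \<and> set ps \<subseteq> squares B}"

definition nat_quotient :: "'a::star_ring set \<Rightarrow> 'a set" where
  "nat_quotient B = {a. \<exists>n>0. nmul n a \<in> B}"

definition self_adjoint_part :: "'a::star_ring set \<Rightarrow> 'a set" where
  "self_adjoint_part B = {b \<in> B. b = star b}"

definition set_prod :: "'a::star_ring set \<Rightarrow> 'a set \<Rightarrow> 'a set" where
  "set_prod B C = {b * c | b c. b \<in> B \<and> c \<in> C}"

definition upper_bd :: "'a::star_ring \<Rightarrow> ereal" where
  "upper_bd a = (SUP b. Inf {ereal (real m / real n) | m n. m > 0 \<and> n > 0 \<and>
      nmul m (b * star b) - nmul n (b * a * star b) \<in> Sigma_sums UNIV})"

definition esqrt :: "ereal \<Rightarrow> ereal" where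
  "esqrt t = (if t = \<infinity> then \<infinity> else ereal (sqrt (real_of_ereal t)))"

definition star_norm :: "'a::star_ring \<Rightarrow> ereal" where
  "star_norm a = esqrt (max (upper_bd (a * star a)) (upper_bd (star a * a)))"

definition star_unit_ball :: "'a::star_ring set" where
  "star_unit_ball = {a. star_norm a \<le> 1}"

definition star_archimedean :: "'a::star_ring itself \<Rightarrow> bool" where
  "star_archimedean _ \<longleftrightarrow> (\<forall>a::'a. upper_bd (- a) = 0 \<longrightarrow> upper_bd a < \<infinity>)"

definition infinitesimal_free :: "'a::star_ring itself \<Rightarrow> bool" where
  "infinitesimal_free _ \<longleftrightarrow> (\<forall>a::'a. upper_bd a = 0 \<and> upper_bd (- a) = 0 \<longrightarrow> a = 0)"

definition star_proper :: "'a::star_ring itself \<Rightarrow> bool" where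
  "star_proper _ \<longleftrightarrow> (\<forall>a::'a. a * star a = 0 \<longrightarrow> a = 0)"

definition unital :: "'a::star_ring itself \<Rightarrow> bool" where
  "unital _ \<longleftrightarrow> (\<exists>e::'a. \<forall>a. e * a = a \<and> a * e = a)"

definition star_le :: "'a::star_ring \<Rightarrow> 'a \<Rightarrow> bool" (infix \<open>\<unlhd>\<close> 50) where
  "a \<unlhd> b \<longleftrightarrow> upper_bd (a - b) = 0"

definition positive_part :: "'a::star_ring set \<Rightarrow> 'a set" where
  "positive_part B = {b \<in> B. 0 \<unlhd> b}"

definition additive_subgroup :: "'a::star_ring set \<Rightarrow> bool" where
  "additive_subgroup L \<longleftrightarrow> 0 \<in> L \<and> (\<forall>a\<in>L. \<forall>b\<in>L. a - b \<in> L)"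

definition star_subsemigroup :: "'a::star_ring set \<Rightarrow> bool" where
  "star_subsemigroup S \<longleftrightarrow> set_prod S S \<subseteq> S \<and> star ` S \<subseteq> S"

definition star_subring :: "'a::star_ring set \<Rightarrow> bool" where
  "star_subring L \<longleftrightarrow> additive_subgroup L \<and> star_subsemigroup L"

definition commutative_on :: "'a::star_ring set \<Rightarrow> bool" where
  "commutative_on L \<longleftrightarrow> (\<forall>a\<in>L. \<forall>b\<in>L. a * b = b * a)"

definition hereditary :: "'a::star_ring set \<Rightarrow> 'a set \<Rightarrow> bool" where
  "hereditary S L \<longleftrightarrow> additive_subgroup L \<and> squares S \<subseteq> L \<and>
     (\<forall>a\<in>positive_part L. \<forall>s\<in>S. a \<unlhd> star s * s \<longrightarrow> a \<in> S)"

definition star_lattice :: "'a::star_ring set \<Rightarrow> bool" where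
  "star_lattice L \<longleftrightarrow> lattice \<lparr>carrier = L, eq = (=), le = (\<unlhd>)\<rparr>"

text \<open>The relation is a partial order, so the order axioms contained in \<^const>\<open>lattice\<close> add
  nothing to the existence of binary suprema and infima.\<close>

lemma upper_bd_eq_0_iff:
  "upper_bd a = 0 \<longleftrightarrow> (\<forall>b. \<forall>\<epsilon>>0. \<exists>m n. m > 0 \<and> n > 0 \<and> real m / real n < \<epsilon> \<and>
     nmul m (b * star b) - nmul n (b * a * star b) \<in> Sigma_sums UNIV)"
proof -
  define X where "X b = {ereal (real m / real n) | m n. m > 0 \<and> n > 0 \<and>
      nmul m (b * star b) - nmul n (b * a * star b) \<in> Sigma_sums UNIV}" for b
  have nn: "0 \<le> Inf (X b)" for b
    by (rule Inf_greatest) (auto simp: X_def)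
  have "upper_bd a = (SUP b. Inf (X b))" by (simp add: upper_bd_def X_def)
  moreover have "0 \<le> (SUP b. Inf (X b))"
    by (rule SUP_upper2[of undefined]) (simp_all add: nn)
  ultimately have "upper_bd a = 0 \<longleftrightarrow> (SUP b. Inf (X b)) \<le> 0"
    by (metis order.eq_iff)
  also have "\<dots> \<longleftrightarrow> (\<forall>b. Inf (X b) \<le> 0)"
    by (simp only: SUP_le_iff ball_UNIV)
  also have "\<dots> \<longleftrightarrow> (\<forall>b. \<forall>\<epsilon>>0. \<exists>x\<in>X b. x < ereal \<epsilon>)"
  proof (intro iff_allI iffI allI impI)
    fix b and \<epsilon> :: real assume "Inf (X b) \<le> 0" "\<epsilon> > 0"
    then have "Inf (X b) < ereal \<epsilon>" by (intro le_less_trans[of "Inf (X b)" 0 "ereal \<epsilon>"]) simp_all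
    then show "\<exists>x\<in>X b. x < ereal \<epsilon>" by (simp add: Inf_less_iff)
  next
    fix b assume *: "\<forall>\<epsilon>>0. \<exists>x\<in>X b. x < ereal \<epsilon>"
    have "Inf (X b) \<le> 0 + ereal e" if e: "0 < e" for e
    proof -
      obtain x where "x \<in> X b" "x < ereal e" using * e by blast
      then show ?thesis by (simp add: Inf_lower2 less_imp_le)
    qed
    then show "Inf (X b) \<le> 0" by (simp add: ereal_le_epsilon2)
  qed
  also have "\<dots> \<longleftrightarrow> (\<forall>b. \<forall>\<epsilon>>0. \<exists>m n. m > 0 \<and> n > 0 \<and> real m / real n < \<epsilon> \<and>
     nmul m (b * star b) - nmul n (b * a * star b) \<in> Sigma_sums UNIV)"
  proof -
    have "(\<exists>x\<in>X b. x < ereal \<epsilon>) \<longleftrightarrow> (\<exists>m n. m > 0 \<and> n > 0 \<and> real m / real n < \<epsilon> \<and>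
        nmul m (b * star b) - nmul n (b * a * star b) \<in> Sigma_sums UNIV)" for b \<epsilon>
    proof -
      have "(\<exists>x\<in>{ereal (real m / real n) | m n. P m n}. x < ereal \<epsilon>) \<longleftrightarrow>
          (\<exists>m n. P m n \<and> real m / real n < \<epsilon>)" for P
        by fastforce
      from this[of "\<lambda>m n. m > 0 \<and> n > 0 \<and>
          nmul m (b * star b) - nmul n (b * a * star b) \<in> Sigma_sums UNIV"]
      show ?thesis unfolding X_def by (simp only: conj_ac)
    qed
    then show ?thesis by simp
  qed
  finally show ?thesis .
qed

lemma nmul_add: "nmul (m + n) a = nmul m a + nmul n a"
  by (induction n) (simp_all add: nmul_def ac_simps)

lemma nmul_add_right: "nmul n (a + b) = nmul n a + nmul n b"
  by (simp add: nmul_def sum.distrib)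

lemma nmul_mult: "nmul (m * n) a = nmul m (nmul n a)"
  by (induction m) (simp_all add: nmul_add, simp_all add: nmul_def ac_simps)

lemma nmul_diff_right: "nmul n (a - b) = nmul n a - nmul n b"
  by (simp add: nmul_def sum_subtractf)

lemma Sigma_sums_add:
  assumes "a \<in> Sigma_sums B" "b \<in> Sigma_sums B" shows "a + b \<in> Sigma_sums B"
proof -
  obtain ps qs where "a = sum_list ps" "ps \<noteq> []" "set ps \<subseteq> squares B"
    "b = sum_list qs" "set qs \<subseteq> squares B" using assms by (auto simp: Sigma_sums_def)
  then show ?thesis unfolding Sigma_sums_def
    by (intro CollectI exI[of _ "ps @ qs"]) auto
qed

lemma Sigma_sums_nmul:
  assumes "a \<in> Sigma_sums B" "n > 0" shows "nmul n a \<in> Sigma_sums B"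
  using assms(2)
proof (induction n rule: nat_induct_non_zero)
  case 1 then show ?case using assms(1) by (simp add: nmul_def)
next
  case (Suc n) then show ?case using assms(1) by (simp add: nmul_def Sigma_sums_add)
qed

lemma star_le_refl: "a \<unlhd> a"
  unfolding star_le_def upper_bd_eq_0_iff
proof (intro allI impI)
  fix b :: 'a and \<epsilon> :: real assume "\<epsilon> > 0"
  then obtain n where n: "n > 0" "inverse (real n) < \<epsilon>" by (metis ex_inverse_of_nat_less)
  have "b * star b = star (star b) * star b" by (simp add: star_star)
  then have "b * star b \<in> squares UNIV" unfolding squares_def by blast
  then have "b * star b \<in> Sigma_sums UNIV" unfolding Sigma_sums_def
    by (intro CollectI exI[of _ "[b * star b]"]) auto
  then show "\<exists>m n. m > 0 \<and> n > 0 \<and> real m / real n < \<epsilon> \<and>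
     nmul m (b * star b) - nmul n (b * (a - a) * star b) \<in> Sigma_sums UNIV"
    using n by (intro exI[of _ 1] exI[of _ n]) (auto simp: nmul_def inverse_eq_divide)
qed

lemma star_le_trans:
  assumes "a \<unlhd> b" "b \<unlhd> c" shows "a \<unlhd> c"
  unfolding star_le_def upper_bd_eq_0_iff
proof (intro allI impI)
  fix x :: 'a and \<epsilon> :: real assume "\<epsilon> > 0"
  then have e: "\<epsilon> / 2 > 0" by simp
  obtain m n where 1: "m > 0" "n > 0" "real m / real n < \<epsilon> / 2"
     "nmul m (x * star x) - nmul n (x * (a - b) * star x) \<in> Sigma_sums UNIV"
    using assms(1) e unfolding star_le_def upper_bd_eq_0_iff by meson
  obtain k l where 2: "k > 0" "l > 0" "real k / real l < \<epsilon> / 2"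
     "nmul k (x * star x) - nmul l (x * (b - c) * star x) \<in> Sigma_sums UNIV"
    using assms(2) e unfolding star_le_def upper_bd_eq_0_iff by meson
  have "x * (a - c) * star x = x * (a - b) * star x + x * (b - c) * star x"
    by (simp add: algebra_simps)
  then have "nmul (l * m + n * k) (x * star x) - nmul (l * n) (x * (a - c) * star x)
    = nmul l (nmul m (x * star x) - nmul n (x * (a - b) * star x))
    + nmul n (nmul k (x * star x) - nmul l (x * (b - c) * star x))"
    by (simp add: nmul_add nmul_add_right nmul_diff_right flip: nmul_mult)
       (simp add: mult.commute)
  moreover have "real (l * m + n * k) / real (l * n) = real m / real n + real k / real l"
    using 1 2 by (simp add: field_simps)
  moreover have "l * m + n * k > 0" "l * n > 0" using 1 2 by simp_all
  moreover have "nmul l (nmul m (x * star x) - nmul n (x * (a - b) * star x))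
    + nmul n (nmul k (x * star x) - nmul l (x * (b - c) * star x)) \<in> Sigma_sums UNIV"
    using 1 2 by (intro Sigma_sums_add Sigma_sums_nmul)
  moreover have "real m / real n + real k / real l < \<epsilon>" using 1 2 by linarith
  ultimately show "\<exists>m n. m > 0 \<and> n > 0 \<and> real m / real n < \<epsilon> \<and>
     nmul m (x * star x) - nmul n (x * (a - c) * star x) \<in> Sigma_sums UNIV"
    by (intro exI[of _ "l * m + n * k"] exI[of _ "l * n"]) (simp only: conj_assoc simp_thms)
qed

lemma partial_order_star_le:
  fixes L :: "'a::star_ring set"
  assumes "infinitesimal_free TYPE('a)"
  shows "partial_order \<lparr>carrier = L, eq = (=), le = (\<unlhd>)\<rparr>"
proof -
  have "a = b" if "a \<unlhd> b" "b \<unlhd> a" for a b :: 'a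
  proof -
    have "upper_bd (a - b) = 0" "upper_bd (- (a - b)) = 0"
      using that by (simp_all add: star_le_def)
    then have "a - b = 0" using assms unfolding infinitesimal_free_def by blast
    then show ?thesis by simp
  qed
  then show ?thesis
    by unfold_locales (auto intro: star_le_refl star_le_trans)
qed


section \<open>Weyl star-semigroups and their ultrafilters\<close>

definition weyl_star_semigroup :: "'a::star_ring set \<Rightarrow> 'a set \<Rightarrow> bool" where
  "weyl_star_semigroup S E \<longleftrightarrow>
     star_subsemigroup S \<and> E \<subseteq> S \<and> set_prod E E \<subseteq> E \<and> star ` E = E \<and>
     (\<forall>a\<in>S. \<forall>e\<in>E. star a * e * a \<in> E) \<and>
     (\<forall>a\<in>S. star a * a \<in> E \<and> (\<forall>e\<in>E. star a * a * e = e * (star a * a)))"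

definition weyl_prec :: "'a::star_ring set \<Rightarrow> 'a \<Rightarrow> 'a \<Rightarrow> bool" where
  "weyl_prec E a b \<longleftrightarrow> a * star b \<in> E \<and> a = a * star b * b"

definition weyl_filter :: "'a::star_ring set \<Rightarrow> 'a set \<Rightarrow> 'a set \<Rightarrow> bool" where
  "weyl_filter S E U \<longleftrightarrow> U \<noteq> {} \<and> U \<subseteq> S \<and>
     (\<forall>a\<in>S. \<forall>b\<in>S. a \<in> U \<and> b \<in> U \<longleftrightarrow> (\<exists>c\<in>U. weyl_prec E c a \<and> weyl_prec E c b))"

definition weyl_ultrafilter :: "'a::star_ring set \<Rightarrow> 'a set \<Rightarrow> 'a set \<Rightarrow> bool" where
  "weyl_ultrafilter S E U \<longleftrightarrow> weyl_filter S E U \<and> U \<noteq> S \<and>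
     (\<forall>V. weyl_filter S E V \<and> V \<noteq> S \<and> U \<subseteq> V \<longrightarrow> V = U)"

definition weyl_basic :: "'a::star_ring set \<Rightarrow> 'a set \<Rightarrow> 'a \<Rightarrow> 'a set set" where
  "weyl_basic S E a = {U. weyl_ultrafilter S E U \<and> a \<in> U}"

text \<open>The family \<open>\<U>\<^sub>a\<close> is used as a subbasis here; \<open>openin_weyl_groupoid\<close> below
  shows that it is a basis.\<close>

definition weyl_groupoid :: "'a::star_ring set \<Rightarrow> 'a set \<Rightarrow> 'a set topology" where
  "weyl_groupoid S E = topology_generated_by (weyl_basic S E ` S)"

lemma topspace_weyl_groupoid: "topspace (weyl_groupoid S E) = {U. weyl_ultrafilter S E U}"
proof -
  have "\<exists>a\<in>S. a \<in> U" if "weyl_ultrafilter S E U" for U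
  proof -
    have "weyl_filter S E U" using that unfolding weyl_ultrafilter_def by (rule conjunct1)
    then have "U \<noteq> {} \<and> U \<subseteq> S"
      unfolding weyl_filter_def by (elim conjE) (intro conjI)
    then show ?thesis by blast
  qed
  then have "\<Union> (weyl_basic S E ` S) = {U. weyl_ultrafilter S E U}"
    unfolding weyl_basic_def by blast
  then show ?thesis by (simp only: weyl_groupoid_def topology_generated_by_topspace)
qed

lemma openin_weyl_groupoid:
  "openin (weyl_groupoid S E) W \<longleftrightarrow> (\<exists>B\<subseteq>S. W = (\<Union>a\<in>B. weyl_basic S E a))"
proof
  assume "openin (weyl_groupoid S E) W"
  then have "generate_topology_on (weyl_basic S E ` S) W"
    by (simp add: weyl_groupoid_def openin_topology_generated_by)
  then have *: "\<forall>U\<in>W. \<exists>a\<in>S. U \<in> weyl_basic S E a \<and> weyl_basic S E a \<subseteq> W"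
  proof induction
    case (Int W1 W2)
    show ?case
    proof
      fix U assume "U \<in> W1 \<inter> W2"
      then obtain a b where ab: "a \<in> S" "b \<in> S" "U \<in> weyl_basic S E a" "U \<in> weyl_basic S E b"
        "weyl_basic S E a \<subseteq> W1" "weyl_basic S E b \<subseteq> W2"
        using Int.IH by (meson IntE)
      then have U: "weyl_filter S E U" "a \<in> U" "b \<in> U" "weyl_ultrafilter S E U"
        by (auto simp: weyl_basic_def weyl_ultrafilter_def)
      then obtain c where c: "c \<in> U" "weyl_prec E c a" "weyl_prec E c b"
        using ab(1,2) unfolding weyl_filter_def by meson
      have "weyl_basic S E c \<subseteq> weyl_basic S E a \<inter> weyl_basic S E b"
      proof
        fix V assume "V \<in> weyl_basic S E c"
        then have V: "weyl_ultrafilter S E V" "weyl_filter S E V" "c \<in> V"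
          by (auto simp: weyl_basic_def weyl_ultrafilter_def)
        then have "a \<in> V \<and> b \<in> V" using ab(1,2) c unfolding weyl_filter_def by meson
        then show "V \<in> weyl_basic S E a \<inter> weyl_basic S E b"
          using V by (simp add: weyl_basic_def)
      qed
      moreover have "c \<in> S" using U(1) c(1) unfolding weyl_filter_def by blast
      moreover have "U \<in> weyl_basic S E c" using U(4) c(1) by (simp add: weyl_basic_def)
      ultimately show "\<exists>a\<in>S. U \<in> weyl_basic S E a \<and> weyl_basic S E a \<subseteq> W1 \<inter> W2"
        using ab(5,6) by blast
    qed
  qed (simp, meson Union_iff Union_upper subset_trans, blast)
  have "W = (\<Union>a\<in>{a \<in> S. weyl_basic S E a \<subseteq> W}. weyl_basic S E a)"
    using * by blast
  then show "\<exists>B\<subseteq>S. W = (\<Union>a\<in>B. weyl_basic S E a)"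
    by (metis (no_types, lifting) mem_Collect_eq subsetI)
next
  assume "\<exists>B\<subseteq>S. W = (\<Union>a\<in>B. weyl_basic S E a)"
  then obtain B where B: "B \<subseteq> S" "W = (\<Union>a\<in>B. weyl_basic S E a)" by blast
  have "openin (weyl_groupoid S E) (weyl_basic S E a)" if "a \<in> B" for a
    unfolding weyl_groupoid_def using B(1) that by (intro topology_generated_by_Basis) auto
  then show "openin (weyl_groupoid S E) W" unfolding B(2)
    by (intro openin_Union) auto
qed

end

theory Submission
  imports Defs
begin

text \<open>Elements of the ring \<open>L\<close> behave like functions on the space of ultrafilters, and the proof carries
out a functional calculus in \<open>L\<close> that uses only integer coefficients and the lattice operations.

\<^bold>\<open>The ring.\<close> Each of the two alternatives in the last hypothesis makes products of positive elements
of \<open>L\<close> positive. Together with the Archimedean property and the bound on the norms it makes every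
\<open>s\<^sup>* s\<close> with \<open>s \<in> S\<close> a contraction, that is \<open>s\<^sup>* s y \<le> y\<close> for all positive \<open>y \<in> L\<close>; this replaces
\<open>s\<^sup>* s \<le> 1\<close>, as \<open>L\<close> may have no unit. If \<open>a\<close> and \<open>b\<close> are contractions with infimum \<open>0\<close>, then
\<open>a b \<le> a\<close> and \<open>a b \<le> b\<close>, hence \<open>a b = 0\<close>: on contractions, lattice disjointness is orthogonality,
as for functions (\<open>disjoint_mult_zero\<close>).

\<^bold>\<open>Plateaus.\<close> Write \<open>a \<lless> b\<close> for the domination relation of \<open>(S, E)\<close>. Let \<open>t \<lless> s\<close>, \<open>u = s\<^sup>* s\<close>,
\<open>q = t\<^sup>* t\<close>, so that \<open>q u = q\<close>. For \<open>h \<ge> u - q\<close> the element \<open>plateau u h\<close>, which is the minimum of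
\<open>2 (u - h)\<^sup>+\<close> and \<open>u\<close>, lies in \<open>S\<close> by heredity; as a function it equals \<open>1\<close> where \<open>h \<le> 1/2\<close> and
vanishes where \<open>h \<ge> 1\<close>. If \<open>2 h \<le> h'\<close>, the plateau of \<open>h\<close> is therefore a unit on the plateau of
\<open>h'\<close> (\<open>plateau_mult_absorb\<close>). A set of heights that is closed under addition thus gives a
downward directed set for \<open>\<lless>\<close>, which generates a filter, and a filter without \<open>0\<close> extends to
an ultrafilter.

\<^bold>\<open>Compactness.\<close> Given an ultrafilter \<open>U\<close> and a basic neighbourhood \<open>\<U>\<^sub>a\<close>, choose
\<open>b \<lless> t \<lless> s \<lless> a\<close> in \<open>U\<close>. Between \<open>\<U>\<^sub>b\<close> and \<open>\<U>\<^sub>a\<close> lies the set \<open>core a\<close> of the ultrafilters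
containing \<open>a\<close> on which, informally, \<open>q = 1\<close>. To see that it is compact, let an open cover be given
and let \<open>C\<close> be the set of all \<open>c \<lless> c1 \<lless> c2 \<lless> a\<close> such that \<open>\<U>\<close> of \<open>c2\<close> lies in a member of the
cover; every point of the core meets \<open>C\<close>. Consider the heights \<open>h = n (u - q) + \<Sum> c\<^sub>j\<^sup>* c\<^sub>j\<close> with
\<open>c\<^sub>j \<in> C\<close>. If no \<open>plateau u h\<close> were \<open>0\<close>, the elements \<open>a (plateau u h)\<^sup>2\<close> would generate a filter;
an ultrafilter above it is in the core, yet contains no element of \<open>C\<close>, a contradiction. Hence
some plateau vanishes, which means \<open>u \<le> n (u - q) + \<Sum> c\<^sub>j\<^sup>* c\<^sub>j\<close>. If an ultrafilter in the core missed
the finitely many members of the cover that belong to these \<open>c\<^sub>j\<close>, it would contain a \<open>z\<close>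
orthogonal to all \<open>c\<^sub>j\<close> (\<open>ultrafilter_separation\<close>). Multiplying the inequality by \<open>z\<^sup>* z\<close> shows
that \<open>z\<close> annihilates \<open>plateau u (n (u - q))\<close>, which the definition of the core excludes.\<close>

abbreviation sq :: "'a::star_ring \<Rightarrow> 'a" where "sq s \<equiv> star s * s"

section \<open>Positivity in a star-ring\<close>

lemma star_zero [simp]: "star (0::'a::star_ring) = 0"
  using star_add[of "0::'a" 0] by simp

lemma star_sum_list: "star (sum_list xs) = sum_list (map star (xs::'a::star_ring list))"
  by (induction xs) (simp_all add: star_add)

lemma nmul_0 [simp]: "nmul 0 a = 0" and nmul_Suc: "nmul (Suc n) a = a + nmul n a"
  by (simp_all add: nmul_def add.commute)

lemma nmul_zero_right [simp]: "nmul n (0::'a::star_ring) = 0"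
  by (simp add: nmul_def)

lemma nmul_minus_right: "nmul n (- a) = - nmul n (a::'a::star_ring)"
  by (simp add: nmul_def sum_negf)

lemma nmul_mult_left: "nmul n a * b = nmul n (a * b :: 'a::star_ring)"
  by (simp add: nmul_def sum_distrib_right)

lemma nmul_mult_right: "a * nmul n b = nmul n (a * b :: 'a::star_ring)"
  by (simp add: nmul_def sum_distrib_left)

lemma star_nmul: "star (nmul n a) = nmul n (star (a::'a::star_ring))"
  by (induction n) (simp_all add: nmul_Suc star_add)

lemma Sigma_sums_sq: "b \<in> B \<Longrightarrow> sq b \<in> Sigma_sums B"
  unfolding Sigma_sums_def squares_def by (intro CollectI exI[of _ "[star b * b]"]) auto

lemma Sigma_sums_UNIV_mult_star: "b * star b \<in> Sigma_sums UNIV"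
  using Sigma_sums_sq[of "star b" UNIV] by (simp add: star_star)

lemma star_Sigma_sums: "a \<in> Sigma_sums B \<Longrightarrow> star a = a"
proof -
  assume "a \<in> Sigma_sums B"
  then obtain ps where a: "a = sum_list ps" and ps: "set ps \<subseteq> squares B"
    by (auto simp: Sigma_sums_def)
  have "map star ps = ps"
    using ps by (intro map_idI) (auto simp: squares_def star_mult star_star)
  then show "star a = a" using a by (simp add: star_sum_list)
qed

lemma star_le_iff_diff: "a \<unlhd> b \<longleftrightarrow> 0 \<unlhd> b - (a::'a::star_ring)"
  by (simp add: star_le_def)

lemma star_nonneg_iff:
  "0 \<unlhd> (x::'a::star_ring) \<longleftrightarrow> (\<forall>b. \<forall>\<epsilon>>0. \<exists>m n. m > 0 \<and> n > 0 \<and> real m / real n < \<epsilon> \<and>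
     nmul m (b * star b) + nmul n (b * x * star b) \<in> Sigma_sums UNIV)"
  by (simp add: star_le_def upper_bd_eq_0_iff nmul_minus_right)

text \<open>Allowing \<open>m = 0\<close> is harmless: adding one copy of \<open>b b\<^sup>*\<close> to a large multiple of the given sum changes
the ratio arbitrarily little.\<close>

lemma star_nonnegI:
  fixes x :: "'a::star_ring"
  assumes "\<And>b \<epsilon>. \<epsilon> > 0 \<Longrightarrow> \<exists>m n. n > 0 \<and> real m / real n < \<epsilon> \<and>
     nmul m (b * star b) + nmul n (b * x * star b) \<in> Sigma_sums UNIV"
  shows "0 \<unlhd> x"
  unfolding star_nonneg_iff
proof (intro allI impI)
  fix b and \<epsilon> :: real assume "\<epsilon> > 0"
  then obtain m n where mn: "n > 0" "real m / real n < \<epsilon> / 2"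
     "nmul m (b * star b) + nmul n (b * x * star b) \<in> Sigma_sums UNIV"
    using assms[of "\<epsilon> / 2" b] \<open>\<epsilon> > 0\<close> by (meson half_gt_zero)
  obtain k where k: "k > 0" "inverse (real k) < \<epsilon> / 2"
    using \<open>\<epsilon> > 0\<close> by (metis ex_inverse_of_nat_less half_gt_zero)
  have "nmul (k * m + 1) (b * star b) + nmul (k * n) (b * x * star b)
      = nmul k (nmul m (b * star b) + nmul n (b * x * star b)) + b * star b"
    by (simp add: nmul_add nmul_add_right nmul_mult nmul_Suc algebra_simps)
  then have "nmul (k * m + 1) (b * star b) + nmul (k * n) (b * x * star b) \<in> Sigma_sums UNIV"
    using mn k by (simp only: Sigma_sums_add Sigma_sums_nmul Sigma_sums_UNIV_mult_star)
  moreover have "real (k * m + 1) / real (k * n) < \<epsilon>"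
  proof -
    have "real (k * m + 1) / real (k * n) = real m / real n + inverse (real k) * (1 / real n)"
      using mn k by (simp add: field_simps)
    also have "\<dots> \<le> real m / real n + inverse (real k) * 1"
      using mn k by (intro add_left_mono mult_left_mono) auto
    finally show ?thesis using mn(2) k(2) by linarith
  qed
  ultimately show "\<exists>m n. m > 0 \<and> n > 0 \<and> real m / real n < \<epsilon> \<and>
     nmul m (b * star b) + nmul n (b * x * star b) \<in> Sigma_sums UNIV"
    using mn k by (intro exI[of _ "k * m + 1"] exI[of _ "k * n"]) simp
qed

lemma star_nonneg_0: "0 \<unlhd> (0::'a::star_ring)"
  by (rule star_le_refl)

lemma star_nonneg_add: "0 \<unlhd> a \<Longrightarrow> 0 \<unlhd> b \<Longrightarrow> 0 \<unlhd> a + (b::'a::star_ring)"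
  using star_le_trans[of 0 a "a + b"] star_le_iff_diff[of a "a + b"] by simp

lemma star_nonneg_nmul: "0 \<unlhd> a \<Longrightarrow> 0 \<unlhd> nmul n (a::'a::star_ring)"
  by (induction n) (simp_all add: nmul_Suc star_nonneg_add star_nonneg_0)

lemma star_nonneg_nmul_cancel:
  fixes a :: "'a::star_ring"
  assumes "0 \<unlhd> nmul k a" "k > 0"
  shows "0 \<unlhd> a"
proof (rule star_nonnegI)
  fix b :: 'a and \<epsilon> :: real assume "\<epsilon> > 0"
  then obtain m n where mn: "n > 0" "real m / real n < \<epsilon>"
     "nmul m (b * star b) + nmul n (b * nmul k a * star b) \<in> Sigma_sums UNIV"
    using assms(1) unfolding star_nonneg_iff by blast
  have "real m / real (n * k) \<le> real m / real n"
    using mn assms(2) by (intro divide_left_mono) auto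
  then show "\<exists>m n. n > 0 \<and> real m / real n < \<epsilon> \<and>
     nmul m (b * star b) + nmul n (b * a * star b) \<in> Sigma_sums UNIV"
    using mn assms(2)
    by (intro exI[of _ m] exI[of _ "n * k"])
      (simp add: nmul_mult nmul_mult_left nmul_mult_right)
qed

lemma sq_nonneg: "0 \<unlhd> sq (p::'a::star_ring)"
proof (rule star_nonnegI)
  fix b :: 'a and \<epsilon> :: real assume "\<epsilon> > 0"
  have "b * (star p * p) * star b = sq (p * star b)" by (simp add: star_mult star_star mult.assoc)
  then have "b * (star p * p) * star b \<in> Sigma_sums UNIV" by (simp only: Sigma_sums_sq UNIV_I)
  then show "\<exists>m n. n > 0 \<and> real m / real n < \<epsilon> \<and>
     nmul m (b * star b) + nmul n (b * (star p * p) * star b) \<in> Sigma_sums UNIV"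
    using \<open>\<epsilon> > 0\<close> by (intro exI[of _ 0] exI[of _ 1]) (simp add: nmul_Suc)
qed

lemma star_nonneg_antisym:
  assumes "infinitesimal_free TYPE('a::star_ring)" "0 \<unlhd> (x::'a)" "0 \<unlhd> - x"
  shows "x = 0"
  using assms unfolding infinitesimal_free_def star_le_def by simp

text \<open>A multiple of \<open>n\<close> contributes nothing to the sum, so the ratio \<open>m / n\<close> can be made arbitrarily small.
Applied to \<open>x\<close> and \<open>- x\<close>, this turns vanishing up to multiples into \<open>x = 0\<close>.\<close>

lemma torsion_infinitesimal:
  fixes x :: "'a::star_ring"
  assumes "\<And>b. \<exists>n>0. nmul n (b * x * star b) = 0"
  shows "0 \<unlhd> x"
proof (rule star_nonnegI)
  fix b :: 'a and \<epsilon> :: real assume "\<epsilon> > 0"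
  obtain n where n: "n > 0" "nmul n (b * x * star b) = 0" using assms by blast
  obtain k where k: "k > 0" "inverse (real k) < \<epsilon>"
    using \<open>\<epsilon> > 0\<close> by (metis ex_inverse_of_nat_less)
  have "1 / real (k * n) \<le> 1 / real k" using n k by (intro divide_left_mono) auto
  with k n show "\<exists>m n. n > 0 \<and> real m / real n < \<epsilon> \<and>
     nmul m (b * star b) + nmul n (b * x * star b) \<in> Sigma_sums UNIV"
    by (intro exI[of _ 1] exI[of _ "k * n"])
      (simp add: nmul_mult Sigma_sums_UNIV_mult_star nmul_Suc inverse_eq_divide)
qed

text \<open>Sums of squares are self-adjoint, so \<open>n b x b\<^sup>*\<close> is self-adjoint for some \<open>n > 0\<close> depending on \<open>b\<close>;
then \<open>x\<^sup>* - x\<close> is infinitesimal.\<close>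

lemma star_nonneg_self_adjoint:
  fixes x :: "'a::star_ring"
  assumes inf: "infinitesimal_free TYPE('a)" and x: "0 \<unlhd> x"
  shows "star x = x"
proof -
  have *: "\<exists>n>0. nmul n (b * (star x - x) * star b) = 0" for b
  proof -
    obtain m n where mn: "n > 0"
      "nmul m (b * star b) + nmul n (b * x * star b) \<in> Sigma_sums UNIV"
      using x unfolding star_nonneg_iff by (meson zero_less_one)
    have "nmul n (b * star x * star b) = nmul n (b * x * star b)"
      using star_Sigma_sums[OF mn(2)]
      by (simp add: star_add star_nmul star_mult star_star mult.assoc)
    then show ?thesis using mn(1)
      by (intro exI[of _ n]) (simp add: algebra_simps nmul_diff_right)
  qed
  have "\<exists>n>0. nmul n (b * - (star x - x) * star b) = 0" for b
    using *[of b] by (metis minus_mult_commute minus_zero mult_minus_right nmul_minus_right)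
  from torsion_infinitesimal[OF this] torsion_infinitesimal[OF *]
  have "star x - x = 0" using star_nonneg_antisym[OF inf] by blast
  then show ?thesis by simp
qed

lemma upper_bd_less_imp:
  assumes "upper_bd a < ereal r"
  shows "\<exists>m n. m > 0 \<and> n > 0 \<and> real m / real n < r \<and>
    nmul m (b * star b) - nmul n (b * a * star b) \<in> Sigma_sums UNIV"
proof -
  let ?X = "{ereal (real m / real n) | m n. m > 0 \<and> n > 0 \<and>
      nmul m (b * star b) - nmul n (b * a * star b) \<in> Sigma_sums UNIV}"
  have "Inf ?X \<le> upper_bd a"
    unfolding upper_bd_def by (rule SUP_upper) simp
  then have "Inf ?X < ereal r" using assms by (rule le_less_trans)
  then obtain x where "x \<in> ?X" "x < ereal r" by (auto simp only: Inf_less_iff)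
  then show ?thesis by (simp, metis ereal_less_eq(3) less_ereal.simps(1))
qed

text \<open>Informally \<open>p\<^sup>* (1 - d) p \<ge> 0\<close> if \<open>d \<le> 1\<close>. For a test element \<open>b\<close> put \<open>c = b p\<^sup>*\<close>. The bound on \<open>d\<close> makes
\<open>m c c\<^sup>* - n c d c\<^sup>*\<close> a sum of squares with \<open>m / n\<close> barely above \<open>1\<close>, and the surplus \<open>(m - n) c c\<^sup>*\<close> has
to be absorbed by a small multiple of \<open>b b\<^sup>*\<close>. That is possible because the Archimedean property
bounds \<open>p\<^sup>* p\<close>.\<close>

lemma sq_compression_le:
  fixes d p :: "'a::star_ring"
  assumes arch: "star_archimedean TYPE('a)" and d: "upper_bd d \<le> 1"
  shows "0 \<unlhd> sq p - star p * d * p"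
proof (rule star_nonnegI)
  fix b :: 'a and \<epsilon> :: real assume e: "\<epsilon> > 0"
  have "upper_bd (- sq p) = 0" using sq_nonneg[of p] by (simp add: star_le_def)
  then have "upper_bd (sq p) < \<infinity>" using arch unfolding star_archimedean_def by blast
  then obtain K where "upper_bd (sq p) < ereal K"
    using less_PInf_Ex_of_nat[of "upper_bd (sq p)"] by auto
  then obtain m' n' where 1: "m' > 0" "n' > 0" "real m' / real n' < K"
      "nmul m' (b * star b) - nmul n' (b * sq p * star b) \<in> Sigma_sums UNIV"
    using upper_bd_less_imp by blast
  then have K: "K > 0" by (meson divide_nonneg_nonneg le_less_trans of_nat_0_le_iff)
  let ?c = "b * star p"
  have "upper_bd d < ereal (1 + \<epsilon> / K)"
    using d e K by (intro le_less_trans[OF d]) simp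
  then obtain m n where 2: "m > 0" "n > 0" "real m / real n < 1 + \<epsilon> / K"
      "nmul m (?c * star ?c) - nmul n (?c * d * star ?c) \<in> Sigma_sums UNIV"
    using upper_bd_less_imp by blast
  let ?C = "?c * star ?c" and ?D = "?c * d * star ?c" and ?B = "b * star b"
  have c: "b * sq p * star b = ?C" by (simp add: star_mult star_star mult.assoc)
  have cd: "b * (sq p - star p * d * p) * star b = ?C - ?D"
    by (simp add: star_mult star_star algebra_simps)
  show "\<exists>m n. n > 0 \<and> real m / real n < \<epsilon> \<and>
     nmul m ?B + nmul n (b * (sq p - star p * d * p) * star b) \<in> Sigma_sums UNIV"
  proof (cases "m \<le> n")
    case True
    then obtain k where n: "n = m + k" using le_Suc_ex by blast
    have "nmul n (?C - ?D) = (nmul m ?C - nmul n ?D) + nmul k ?C"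
      by (simp add: n nmul_diff_right nmul_add)
    moreover have "nmul m ?C - nmul n ?D + nmul k ?C \<in> Sigma_sums UNIV"
      using 2(4) by (cases "k = 0") (simp_all add: Sigma_sums_add Sigma_sums_nmul Sigma_sums_UNIV_mult_star)
    ultimately show ?thesis using 2 e unfolding cd
      by (intro exI[of _ 0] exI[of _ n]) simp
  next
    case False
    then obtain k where m: "m = n + k" "k > 0" by (metis less_imp_add_positive not_le)
    have "nmul (k * m') ?B + nmul (n * n') (?C - ?D)
        = nmul n' (nmul m ?C - nmul n ?D) + nmul k (nmul m' ?B - nmul n' ?C)"
      unfolding m by (simp add: nmul_diff_right nmul_add nmul_add_right flip: nmul_mult)
        (simp add: mult.commute nmul_diff_right)
    then have *: "nmul (k * m') ?B + nmul (n * n') (?C - ?D) \<in> Sigma_sums UNIV"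
      using 1 2 m unfolding c by (simp only: Sigma_sums_add Sigma_sums_nmul)
    have "real k / real n < \<epsilon> / K" using 2 m by (simp add: add_divide_distrib)
    then have "(real k / real n) * (real m' / real n') < \<epsilon> / K * K"
      using 1 e K by (intro mult_strict_mono) auto
    then have "real (k * m') / real (n * n') < \<epsilon>" using K by simp
    then show ?thesis using * 1 2 unfolding cd
      by (intro exI[of _ "k * m'"] exI[of _ "n * n'"]) simp
  qed
qed

lemma upper_bd_sq_unit_ball:
  assumes "s \<in> star_unit_ball" shows "upper_bd (sq s) \<le> 1"
proof -
  let ?t = "max (upper_bd (s * star s)) (upper_bd (sq s))"
  have "esqrt ?t \<le> 1" using assms by (simp add: star_unit_ball_def star_norm_def)
  then have "?t \<le> 1"
    by (cases ?t) (auto simp: esqrt_def split: if_splits)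
  then show ?thesis by simp
qed

section \<open>Lattice-ordered commutative subrings\<close>

text \<open>The order is the one of the whole star-ring, so the laws of an ordered abelian group are available
without membership conditions; only products and positive parts are confined to \<open>L\<close>. An inequality
\<open>a \<unlhd> b\<close> is written here as \<open>0 \<unlhd> b - a\<close>: inequalities are then combined by writing the difference as
a sum of positive terms.\<close>

locale lattice_ordered_subring =
  fixes L :: "'a::star_ring set"
  assumes inf_free: "infinitesimal_free TYPE('a)"
    and proper: "star_proper TYPE('a)"
    and subring: "star_subring L"
    and comm: "commutative_on L"
    and lattice: "star_lattice L"
    and nonneg_mult: "\<lbrakk>x \<in> L; y \<in> L; 0 \<unlhd> x; 0 \<unlhd> y\<rbrakk> \<Longrightarrow> 0 \<unlhd> x * y"
begin

lemma L_zero [simp]: "0 \<in> L" and L_diff: "x \<in> L \<Longrightarrow> y \<in> L \<Longrightarrow> x - y \<in> L"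
  using subring by (simp_all add: star_subring_def additive_subgroup_def)

lemma L_minus: "x \<in> L \<Longrightarrow> - x \<in> L"
  using L_diff[of 0 x] by simp

lemma L_add: "x \<in> L \<Longrightarrow> y \<in> L \<Longrightarrow> x + y \<in> L"
  using L_diff[of x "- y"] L_minus[of y] by simp

lemma L_mult: "x \<in> L \<Longrightarrow> y \<in> L \<Longrightarrow> x * y \<in> L"
  using subring by (auto simp: star_subring_def star_subsemigroup_def set_prod_def)

lemma L_nmul: "x \<in> L \<Longrightarrow> nmul n x \<in> L"
  by (induction n) (simp_all add: nmul_Suc L_add)

lemmas L_closed = L_zero L_diff L_minus L_add L_mult L_nmul

lemma L_comm: "x \<in> L \<Longrightarrow> y \<in> L \<Longrightarrow> x * y = y * x"
  using comm by (simp add: commutative_on_def)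

lemma nonneg_antisym: "0 \<unlhd> x \<Longrightarrow> 0 \<unlhd> - x \<Longrightarrow> (x::'a) = 0"
  using star_nonneg_antisym[OF inf_free] .

lemma nonneg_self_adjoint: "0 \<unlhd> x \<Longrightarrow> star x = (x::'a)"
  using star_nonneg_self_adjoint[OF inf_free] .

text \<open>Positive elements are self-adjoint, so properness makes \<open>L\<close> reduced on its positive elements.\<close>

lemma nonneg_square_zero: "0 \<unlhd> x \<Longrightarrow> x * x = 0 \<Longrightarrow> (x::'a) = 0"
  using proper nonneg_self_adjoint[of x] unfolding star_proper_def by metis

lemma positive_part_exists:
  assumes "w \<in> L"
  shows "\<exists>z. z \<in> L \<and> 0 \<unlhd> z \<and> 0 \<unlhd> z - w \<and> (\<forall>t\<in>L. 0 \<unlhd> t \<longrightarrow> 0 \<unlhd> t - w \<longrightarrow> 0 \<unlhd> t - z)"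
proof -
  let ?G = "\<lparr>carrier = L, eq = (=), le = (\<unlhd>)\<rparr>"
  interpret lattice ?G using lattice by (simp add: star_lattice_def)
  obtain z where "least ?G z (Upper ?G {w, 0})"
    using sup_of_two_exists[of w 0] assms by auto
  then show ?thesis
    unfolding least_def Upper_def using assms star_le_iff_diff[of w] star_le_iff_diff[of z]
    by (intro exI[of _ z]) auto
qed

definition pos_part :: "'a \<Rightarrow> 'a" where
  "pos_part w = (SOME z. z \<in> L \<and> 0 \<unlhd> z \<and> 0 \<unlhd> z - w \<and>
     (\<forall>t\<in>L. 0 \<unlhd> t \<longrightarrow> 0 \<unlhd> t - w \<longrightarrow> 0 \<unlhd> t - z))"

lemma
  assumes "w \<in> L"
  shows pos_part_in: "pos_part w \<in> L"
    and pos_part_nonneg: "0 \<unlhd> pos_part w"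
    and pos_part_ge: "0 \<unlhd> pos_part w - w"
    and pos_part_least: "\<lbrakk>t \<in> L; 0 \<unlhd> t; 0 \<unlhd> t - w\<rbrakk> \<Longrightarrow> 0 \<unlhd> t - pos_part w"
  using someI_ex[OF positive_part_exists[OF assms]] unfolding pos_part_def by blast+

text \<open>The substitute for \<open>0 \<le> x \<le> 1\<close> in a ring that may lack a unit.\<close>

definition contraction :: "'a \<Rightarrow> bool" where
  "contraction x \<longleftrightarrow> x \<in> L \<and> 0 \<unlhd> x \<and> (\<forall>y\<in>L. 0 \<unlhd> y \<longrightarrow> 0 \<unlhd> y - x * y)"

lemma contractionD:
  assumes "contraction x" shows "x \<in> L" "0 \<unlhd> x" "y \<in> L \<Longrightarrow> 0 \<unlhd> y \<Longrightarrow> 0 \<unlhd> y - x * y"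
  using assms by (auto simp: contraction_def)

lemma contraction_downward:
  assumes u: "contraction u" and x: "x \<in> L" "0 \<unlhd> x" "0 \<unlhd> u - x"
  shows "contraction x"
  unfolding contraction_def
proof (intro conjI ballI impI x)
  fix y assume y: "y \<in> L" "0 \<unlhd> y"
  have "y - x * y = (y - u * y) + (u - x) * y" by (simp add: algebra_simps)
  moreover have "0 \<unlhd> (u - x) * y"
    using contractionD[OF u] x y by (intro nonneg_mult L_diff) auto
  ultimately show "0 \<unlhd> y - x * y"
    using contractionD(3)[OF u y] by (simp only: star_nonneg_add)
qed

text \<open>Induction on \<open>n\<close>: a lower bound \<open>z\<close> of \<open>(n + 1) a\<close> and \<open>b\<close> yields the lower bound \<open>z - a\<close> of \<open>n a\<close> and
\<open>b\<close>, so \<open>z \<le> a\<close>, and the disjointness of \<open>a\<close> and \<open>b\<close> applies to \<open>z\<close>.\<close>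

lemma disjoint_multiple:
  assumes "a \<in> L" "0 \<unlhd> a"
    and disj: "\<And>z. \<lbrakk>z \<in> L; 0 \<unlhd> a - z; 0 \<unlhd> b - z\<rbrakk> \<Longrightarrow> 0 \<unlhd> - z"
  shows "\<lbrakk>z \<in> L; 0 \<unlhd> nmul n a - z; 0 \<unlhd> b - z\<rbrakk> \<Longrightarrow> 0 \<unlhd> - z"
proof (induction n arbitrary: z)
  case (Suc n)
  have "0 \<unlhd> - (z - a)"
  proof (rule Suc.IH)
    show "0 \<unlhd> nmul n a - (z - a)" using Suc.prems(2) by (simp add: nmul_Suc algebra_simps)
    have "b - (z - a) = (b - z) + a" by simp
    then show "0 \<unlhd> b - (z - a)" using Suc.prems(3) assms(2) by (simp only: star_nonneg_add)
  qed (use Suc.prems assms in \<open>simp add: L_diff\<close>)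
  then show ?case using disj[of z] Suc.prems by simp
qed simp

text \<open>The bridge from the lattice to the ring: \<open>a b \<le> b\<close> because \<open>a\<close> is a contraction, and
\<open>a b \<le> n a u \<le> n a\<close>, while \<open>b\<close> and \<open>n a\<close> have infimum \<open>0\<close>.\<close>

lemma disjoint_mult_zero:
  assumes a: "contraction a" and b: "b \<in> L" "0 \<unlhd> b"
    and u: "contraction u" "0 \<unlhd> nmul n u - b"
    and disj: "\<And>z. \<lbrakk>z \<in> L; 0 \<unlhd> a - z; 0 \<unlhd> b - z\<rbrakk> \<Longrightarrow> 0 \<unlhd> - z"
  shows "a * b = 0"
proof (rule nonneg_antisym)
  note aL = contractionD(1,2)[OF a] and uL = contractionD(1,2)[OF u(1)]
  show "0 \<unlhd> a * b" using aL b by (simp add: nonneg_mult)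
  have "nmul n a - a * b = a * (nmul n u - b) + nmul n (a - u * a)"
    using aL uL by (simp add: algebra_simps nmul_mult_right nmul_diff_right L_comm)
  moreover have "0 \<unlhd> a * (nmul n u - b)"
    using aL uL b u(2) by (simp add: nonneg_mult L_closed)
  moreover have "0 \<unlhd> nmul n (a - u * a)"
    using contractionD(3)[OF u(1)] aL by (simp add: star_nonneg_nmul)
  ultimately have "0 \<unlhd> nmul n a - a * b" by (simp only: star_nonneg_add)
  then show "0 \<unlhd> - (a * b)"
    using disjoint_multiple[of a b "a * b" n] disj aL b contractionD(3)[OF a b]
    by (simp add: L_mult)
qed

text \<open>The infimum of the positive and the negative part of \<open>w\<close> is \<open>0\<close>: if \<open>z\<close> is below both, then
\<open>w\<^sup>+ - z\<close> still lies above \<open>0\<close> and \<open>w\<close>, hence above \<open>w\<^sup>+\<close>.\<close>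

lemma pos_part_disjoint:
  assumes "w \<in> L" "z \<in> L" "0 \<unlhd> pos_part w - z" "0 \<unlhd> (pos_part w - w) - z"
  shows "0 \<unlhd> - z"
  using pos_part_least[OF assms(1), of "pos_part w - z"] assms pos_part_in[OF assms(1)]
  by (simp add: L_diff algebra_simps)

lemma pos_part_mult_neg_part:
  assumes w: "w \<in> L" and c: "contraction (pos_part w)"
    and u: "contraction u" "0 \<unlhd> nmul n u - (pos_part w - w)"
  shows "pos_part w * (pos_part w - w) = 0"
  using pos_part_in[OF w] pos_part_ge[OF w] w pos_part_disjoint[OF w]
  by (intro disjoint_mult_zero[OF c _ _ u]) (auto simp: L_diff)

text \<open>Since \<open>u\<close> is a contraction, both \<open>x - x u\<close> and \<open>(q - x) - (q - x) u = - (x - x u)\<close> are positive.\<close>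

lemma unit_of_dominated:
  assumes x: "x \<in> L" "0 \<unlhd> x" "0 \<unlhd> q - x" and q: "q \<in> L" "q * u = q" and u: "contraction u"
  shows "x * u = x"
proof -
  note uL = contractionD(1,2)[OF u]
  have "0 \<unlhd> x - x * u"
    using contractionD(3)[OF u x(1,2)] by (simp add: L_comm[OF x(1) uL(1)])
  moreover have "0 \<unlhd> (q - x) - u * (q - x)"
    using x q by (intro contractionD(3)[OF u]) (auto simp: L_diff)
  then have "0 \<unlhd> - (x - x * u)"
    using x q uL by (simp add: L_comm[OF uL(1)] L_diff algebra_simps)
  ultimately show ?thesis using nonneg_antisym[of "x - x * u"] by simp
qed

lemma zero_of_dominated:
  assumes x: "x \<in> L" "0 \<unlhd> x" "0 \<unlhd> q - x" and e: "e \<in> L" "0 \<unlhd> e" and q: "q \<in> L" "e * q = 0"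
  shows "e * x = 0"
proof (rule nonneg_antisym)
  show "0 \<unlhd> e * x" using x e by (simp add: nonneg_mult)
  have "0 \<unlhd> e * (q - x)" using x e q by (simp add: nonneg_mult L_diff)
  then show "0 \<unlhd> - (e * x)" using q by (simp add: algebra_simps)
qed

text \<open>Where \<open>e > 0\<close> one has \<open>w \<le> 0\<close>, so \<open>e\<close> should annihilate \<open>w\<^sup>+\<close>. Algebraically, \<open>w\<^sup>+ w\<^sup>+ = w\<^sup>+ w\<close> gives
\<open>(e w\<^sup>+)\<^sup>2 = e w\<^sup>+ (e w) \<le> 0\<close>.\<close>

lemma mult_pos_part_zero:
  assumes w: "w \<in> L" and c: "contraction (pos_part w)"
    and u: "contraction u" "0 \<unlhd> nmul n u - (pos_part w - w)"
    and e: "e \<in> L" "0 \<unlhd> e" "0 \<unlhd> - (e * w)"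
  shows "e * pos_part w = 0"
proof -
  define p where "p = pos_part w"
  have p: "p \<in> L" "0 \<unlhd> p" using pos_part_in[OF w] pos_part_nonneg[OF w] by (simp_all add: p_def)
  have pp: "p * p = p * w"
    using pos_part_mult_neg_part[OF w c u] by (simp add: p_def algebra_simps)
  have "- ((e * p) * (e * p)) = (e * p) * - (e * w)"
  proof -
    have "(e * p) * (e * p) = e * (p * e) * p" by (simp add: mult.assoc)
    also have "\<dots> = e * (e * (p * p))"
      unfolding L_comm[OF p(1) e(1)] by (simp add: mult.assoc)
    also have "\<dots> = e * (e * p) * w" unfolding pp by (simp add: mult.assoc)
    also have "\<dots> = e * (p * e) * w" unfolding L_comm[OF p(1) e(1)] ..
    finally show ?thesis by (simp add: mult.assoc)
  qed
  moreover have "0 \<unlhd> (e * p) * - (e * w)"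
    using p e w by (intro nonneg_mult) (auto simp: L_closed nonneg_mult)
  moreover have ep: "0 \<unlhd> e * p" "e * p \<in> L" using p e by (auto simp: L_closed nonneg_mult)
  moreover have "0 \<unlhd> (e * p) * (e * p)" using ep by (simp add: nonneg_mult)
  ultimately have "(e * p) * (e * p) = 0" by (metis nonneg_antisym)
  then show ?thesis using nonneg_square_zero[OF ep(1)] by (simp add: p_def)
qed

section \<open>Plateaus\<close>

text \<open>This is the minimum of \<open>2 (u - h)\<^sup>+\<close> and \<open>u\<close>, expressed by positive parts through
\<open>min x u = u - (u - x)\<^sup>+\<close>. For functions and \<open>u = 1\<close> it equals \<open>1\<close> where \<open>h \<le> 1/2\<close> and \<open>0\<close> where
\<open>h \<ge> 1\<close>.\<close>

definition plateau :: "'a \<Rightarrow> 'a \<Rightarrow> 'a" where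
  "plateau u h = u - pos_part (u - (pos_part (u - h) + pos_part (u - h)))"

context
  fixes u h
  assumes u: "contraction u" and h: "h \<in> L" "0 \<unlhd> h"
begin

private lemma uL: "u \<in> L" "0 \<unlhd> u"
  using contractionD[OF u] by auto

private lemma in_L: "pos_part (u - h) \<in> L" "u - (pos_part (u - h) + pos_part (u - h)) \<in> L" "u - h \<in> L"
  using uL h by (auto simp: L_closed pos_part_in)

lemma pos_part_diff_le: "0 \<unlhd> u - pos_part (u - h)"
  using uL h by (intro pos_part_least) (auto simp: L_closed)

lemma contraction_pos_part_diff: "contraction (pos_part (u - h))"
  using pos_part_diff_le in_L pos_part_nonneg[of "u - h"] by (intro contraction_downward[OF u]) auto

lemma plateau_in: "plateau u h \<in> L"
  unfolding plateau_def using uL in_L by (auto simp: L_closed pos_part_in)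

lemma plateau_nonneg: "0 \<unlhd> plateau u h"
  unfolding plateau_def using uL in_L pos_part_nonneg[of "u - h"]
  by (intro pos_part_least) (auto simp: star_nonneg_add)

lemma plateau_le: "0 \<unlhd> u - plateau u h"
  unfolding plateau_def using pos_part_nonneg[OF in_L(2)] by simp

lemma plateau_le_double: "0 \<unlhd> (pos_part (u - h) + pos_part (u - h)) - plateau u h"
  unfolding plateau_def using pos_part_ge[OF in_L(2)] by (simp add: algebra_simps)

lemma diff_plateau_le: "0 \<unlhd> (h + h) - (u - plateau u h)"
proof -
  let ?p = "pos_part (u - h)"
  have "(h + h) - (u - (?p + ?p)) = (?p - (u - h)) + (?p - (u - h)) + u"
    by (simp add: algebra_simps)
  then have "0 \<unlhd> (h + h) - (u - (?p + ?p))"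
    using uL pos_part_ge[OF in_L(3)] by (simp only: star_nonneg_add)
  then have "0 \<unlhd> (h + h) - pos_part (u - (?p + ?p))"
    using h in_L by (intro pos_part_least) (auto simp: L_closed star_nonneg_add)
  then show ?thesis by (simp add: plateau_def)
qed

text \<open>Since \<open>(u - h)\<^sup>+\<close> is below both \<open>2 (u - h)\<^sup>+\<close> and \<open>u\<close>, it is below the plateau.\<close>

lemma plateau_zero_imp_le: "plateau u h = 0 \<Longrightarrow> 0 \<unlhd> h - u"
proof -
  let ?p = "pos_part (u - h)"
  assume 0: "plateau u h = 0"
  have "0 \<unlhd> (u - ?p) - pos_part (u - (?p + ?p))"
    using uL h in_L pos_part_diff_le pos_part_nonneg[OF in_L(3)]
    by (intro pos_part_least) (auto simp: L_closed algebra_simps)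
  also have "(u - ?p) - pos_part (u - (?p + ?p)) = plateau u h - ?p"
    by (simp add: plateau_def)
  finally have "?p = 0" using 0 pos_part_nonneg[OF in_L(3)] by (simp add: nonneg_antisym)
  then show ?thesis using pos_part_ge[OF in_L(3)] by simp
qed

text \<open>The defect \<open>u - plateau u h\<close> is at most \<open>2 h\<close>, which vanishes on \<open>p\<close>.\<close>

lemma plateau_eq_one:
  assumes "p \<in> L" "0 \<unlhd> p" "p * u = p" "p * h = 0"
  shows "p * plateau u h = p"
proof -
  have "p * (u - plateau u h) = 0"
    using assms diff_plateau_le h uL plateau_le plateau_in
    by - (rule zero_of_dominated[of _ "h + h"], auto simp: L_closed distrib_left)
  then show ?thesis using assms by (simp add: right_diff_distrib)
qed

text \<open>As the plateau is at most \<open>2 (u - h)\<^sup>+ \<le> 2 w\<^sup>+\<close>, it vanishes wherever \<open>w \<le> 0\<close>.\<close>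

lemma mult_plateau_zero:
  assumes w: "w \<in> L" "0 \<unlhd> w - (u - h)" "0 \<unlhd> u - w"
    and v: "contraction v" "0 \<unlhd> nmul n v - (u - w)"
    and e: "e \<in> L" "0 \<unlhd> e" "0 \<unlhd> - (e * w)"
  shows "e * plateau u h = 0"
proof -
  have pw: "pos_part w \<in> L" "0 \<unlhd> pos_part w" "0 \<unlhd> pos_part w - w" 
    using w by (auto simp: pos_part_in pos_part_nonneg pos_part_ge)
  have "0 \<unlhd> u - pos_part w" using w uL by (intro pos_part_least) auto
  then have c: "contraction (pos_part w)" using pw by (intro contraction_downward[OF u]) auto
  have "nmul n v - (pos_part w - w) = (nmul n v - (u - w)) + (u - pos_part w)" by simp
  then have "0 \<unlhd> nmul n v - (pos_part w - w)"
    using v(2) \<open>0 \<unlhd> u - pos_part w\<close> by (simp only: star_nonneg_add)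
  then have ep: "e * pos_part w = 0"
    using mult_pos_part_zero[OF w(1) c v(1)] e by blast
  have "pos_part w - (u - h) = (pos_part w - w) + (w - (u - h))" by simp
  then have "0 \<unlhd> pos_part w - (u - h)" using pw w by (simp only: star_nonneg_add)
  then have le: "0 \<unlhd> pos_part w - pos_part (u - h)"
    using pw in_L by (intro pos_part_least) auto
  have "e * pos_part (u - h) = 0"
    using pw le ep e in_L pos_part_nonneg[of "u - h"]
    by - (rule zero_of_dominated[of _ "pos_part w"], auto)
  then show ?thesis
    using plateau_in plateau_nonneg plateau_le_double in_L e
    by - (rule zero_of_dominated[of _ "pos_part (u - h) + pos_part (u - h)"], auto simp: L_closed distrib_left)
qed

text \<open>The plateau is at most \<open>2 q\<close> because \<open>u - h \<le> q\<close>, and \<open>u\<close> acts as a unit on \<open>q\<close>.\<close>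

lemma plateau_unit:
  assumes q: "q \<in> L" "0 \<unlhd> q" "q * u = q" and hq: "0 \<unlhd> h - (u - q)"
  shows "plateau u h * u = plateau u h"
proof -
  have "0 \<unlhd> q - pos_part (u - h)"
    using q hq in_L by (intro pos_part_least) (auto simp: algebra_simps)
  moreover have "(q + q) - plateau u h = (q - pos_part (u - h)) + (q - pos_part (u - h))
      + ((pos_part (u - h) + pos_part (u - h)) - plateau u h)" by (simp add: algebra_simps)
  ultimately have "0 \<unlhd> (q + q) - plateau u h"
    using plateau_le_double by (simp only: star_nonneg_add)
  then show ?thesis
    using q plateau_in plateau_nonneg u
    by - (rule unit_of_dominated[of _ "q + q"], auto simp: L_closed distrib_right)
qed

end

text \<open>The plateau of \<open>h'\<close> lives where \<open>h' < u\<close>, whereas the defect \<open>r = u - plateau u h\<close> is at most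
\<open>(2 h - u)\<^sup>+ \<le> (h' - u)\<^sup>+\<close>. So the two are disjoint, and their product is \<open>0\<close>. The condition
\<open>h \<ge> u - q\<close> confines the plateaus to the region where \<open>u\<close> acts as a unit.\<close>

lemma plateau_mult_absorb:
  assumes u: "contraction u" and q: "q \<in> L" "0 \<unlhd> q" "q * u = q"
    and h: "h \<in> L" "0 \<unlhd> h" "0 \<unlhd> h - (u - q)"
    and h': "h' \<in> L" "0 \<unlhd> h' - (h + h)"
  shows "plateau u h' * plateau u h = plateau u h'"
proof -
  note uL = contractionD(1,2)[OF u]
  have "h' = (h' - (h + h)) + (h + h)" by simp
  then have h'0: "0 \<unlhd> h'" using h h' by (metis star_nonneg_add)
  have "h' - (u - q) = (h' - (h + h)) + (h - (u - q)) + h" by simp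
  then have h'q: "0 \<unlhd> h' - (u - q)" using h h' by (simp only: star_nonneg_add)
  define p' where "p' = pos_part (u - h')"
  define p where "p = pos_part (u - h)"
  define r where "r = u - plateau u h"
  have w: "u - h' \<in> L" "u - h \<in> L" using uL h h' by (auto simp: L_closed)
  have p': "p' \<in> L" "0 \<unlhd> p'" "0 \<unlhd> p' - (u - h')" 
    using w by (auto simp: p'_def pos_part_in pos_part_nonneg pos_part_ge)
  have p: "p \<in> L" "0 \<unlhd> p - (u - h)"
    using w by (auto simp: p_def pos_part_in pos_part_ge)
  have r: "r \<in> L" "0 \<unlhd> r" "r = pos_part (u - (p + p))"
  proof -
    show "r \<in> L" using plateau_in[OF u h(1,2)] uL by (simp add: r_def L_diff)
    show "0 \<unlhd> r" using plateau_le[OF u h(1,2)] by (simp add: r_def)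
    show "r = pos_part (u - (p + p))" by (simp add: r_def plateau_def p_def)
  qed
  have rp': "0 \<unlhd> (p' - (u - h')) - r"
  proof -
    have "(p' - (u - h')) - (u - (p + p)) = p' + (h' - (h + h)) + (p - (u - h)) + (p - (u - h))"
      by (simp add: algebra_simps)
    then have "0 \<unlhd> (p' - (u - h')) - (u - (p + p))"
      using p p' h' by (simp only: star_nonneg_add)
    then show ?thesis unfolding r(3) using p' p uL w by (intro pos_part_least) (auto simp: L_closed)
  qed
  \<comment> \<open>The negative part \<open>(h' - u)\<^sup>+\<close> of \<open>u - h'\<close> may be unbounded; its part \<open>r \<le> u\<close> is bounded, as
    the orthogonality of disjoint elements requires.\<close>
  have "p' * r = 0"
  proof (rule disjoint_mult_zero[of _ _ u 1])
    show "contraction p'"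
      unfolding p'_def using contraction_pos_part_diff[OF u h'(1) h'0] .
    show "0 \<unlhd> nmul 1 u - r"
      using plateau_nonneg[OF u h(1,2)] by (simp add: nmul_Suc r_def)
    fix z assume z: "z \<in> L" "0 \<unlhd> p' - z" "0 \<unlhd> r - z"
    have "(p' - (u - h')) - z = ((p' - (u - h')) - r) + (r - z)" by simp
    then have "0 \<unlhd> (p' - (u - h')) - z" using rp' z by (simp only: star_nonneg_add)
    then show "0 \<unlhd> - z" using pos_part_disjoint[OF w(1) z(1)] z by (simp add: p'_def)
  qed (use r u in auto)
  then have "r * (p' + p') = 0" using L_comm[OF p'(1) r(1)] by (simp add: distrib_left)
  then have "r * plateau u h' = 0"
    using plateau_in[OF u h'(1) h'0] plateau_nonneg[OF u h'(1) h'0] plateau_le_double[OF u h'(1) h'0] r p'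
    by - (rule zero_of_dominated[of _ "p' + p'"], auto simp: L_closed p'_def)
  then have "plateau u h' * (u - plateau u h) = 0"
    using L_comm[OF plateau_in[OF u h'(1) h'0] r(1)] by (simp add: r_def)
  then show ?thesis
    using plateau_unit[OF u h'(1) h'0 q h'q] by (simp add: right_diff_distrib)
qed

end

text \<open>Properness speaks of \<open>a a\<^sup>*\<close>; applying it to \<open>x\<^sup>*\<close> gives the version for \<open>x\<^sup>* x\<close>.\<close>

lemma sq_eq_zero_iff:
  assumes "star_proper TYPE('a::star_ring)"
  shows "sq (x::'a) = 0 \<longleftrightarrow> x = 0"
proof
  assume "sq x = 0"
  then have "star x = 0" using assms unfolding star_proper_def by (metis star_star)
  then show "x = 0" by (metis star_star star_zero)
qed simp

section \<open>Weyl semigroups, filters and ultrafilters\<close>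

locale weyl_semigroup =
  fixes S E :: "'a::star_ring set"
  assumes weyl: "weyl_star_semigroup S E" and S_zero: "0 \<in> S"
begin

abbreviation prec :: "'a \<Rightarrow> 'a \<Rightarrow> bool" (infix \<open>\<lless>\<close> 50) where
  "a \<lless> b \<equiv> weyl_prec E a b"

lemma S_mult: "a \<in> S \<Longrightarrow> b \<in> S \<Longrightarrow> a * b \<in> S"
  and S_star: "a \<in> S \<Longrightarrow> star a \<in> S"
  and E_sub: "e \<in> E \<Longrightarrow> e \<in> S"
  and E_mult: "e \<in> E \<Longrightarrow> f \<in> E \<Longrightarrow> e * f \<in> E"
  and E_star: "e \<in> E \<Longrightarrow> star e \<in> E"
  and E_conj: "a \<in> S \<Longrightarrow> e \<in> E \<Longrightarrow> star a * e * a \<in> E"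
  and sq_in_E: "a \<in> S \<Longrightarrow> sq a \<in> E"
  and sq_comm_E: "a \<in> S \<Longrightarrow> e \<in> E \<Longrightarrow> sq a * e = e * sq a"
  using weyl unfolding weyl_star_semigroup_def star_subsemigroup_def set_prod_def by blast+

lemma E_conj': "a \<in> S \<Longrightarrow> e \<in> E \<Longrightarrow> a * e * star a \<in> E"
  using E_conj[of "star a" e] by (simp add: S_star star_star)

lemma precD: "a \<lless> b \<Longrightarrow> a * star b \<in> E" "a \<lless> b \<Longrightarrow> a * sq b = a"
  by (simp_all add: weyl_prec_def mult.assoc)

lemma precI: "a * star b \<in> E \<Longrightarrow> a * sq b = a \<Longrightarrow> a \<lless> b"
  by (simp add: weyl_prec_def mult.assoc)

lemma prec_sq: "a \<lless> b \<Longrightarrow> sq a * sq b = sq a"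
  using precD(2)[of a b] by (simp add: mult.assoc)

lemma prec_factor: "a \<lless> b \<Longrightarrow> a * x = a * star b * (b * x)"
  using arg_cong[OF precD(2)[of a b], of "\<lambda>y. y * x"] by (simp add: mult.assoc)

lemma prec_trans: 
  assumes ab: "a \<lless> b" and bc: "b \<lless> c" shows "a \<lless> c"
proof (rule precI)
  have "a * star c = (a * sq b) * star c" by (simp only: precD[OF ab])
  also have "\<dots> = (a * star b) * (b * star c)" by (simp add: mult.assoc)
  finally show "a * star c \<in> E" using precD[OF ab] precD[OF bc] E_mult by simp
  have "a * sq c = a * star b * (b * sq c)" using precD(2)[OF ab] by (metis mult.assoc)
  then show "a * sq c = a" using precD[OF ab] precD[OF bc] by (simp add: mult.assoc)
qed

lemma zero_prec: "0 \<lless> s"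
  using sq_in_E[OF S_zero] by (intro precI) auto

lemma prec_zero: "a \<lless> 0 \<Longrightarrow> a = 0"
  using precD(2)[of a 0] by simp

text \<open>Write \<open>v e t\<^sup>* = (v t\<^sup>*) (t e t\<^sup>*)\<close>; both factors lie in \<open>E\<close>.\<close>

lemma prec_mult_E_left:
  assumes vt: "v \<lless> t" and "t \<in> S" "e \<in> E" shows "v * e \<lless> t"
proof (rule precI)
  have "v * e * star t = (v * sq t) * e * star t" by (simp only: precD[OF vt])
  also have "\<dots> = (v * star t) * (t * e * star t)" by (simp add: mult.assoc)
  finally show "v * e * star t \<in> E" using precD[OF vt] assms E_mult E_conj' by simp
  have "v * e * sq t = v * (e * sq t)" by (simp add: mult.assoc)
  also have "\<dots> = v * sq t * e" using assms by (simp only: sq_comm_E[symmetric] mult.assoc)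
  finally show "v * e * sq t = v * e" using precD[OF vt] by simp
qed

text \<open>This lemma and \<open>mult_prec_mult\<close> turn the absorption \<open>f e = f\<close> inside \<open>E\<close> into domination in \<open>S\<close>; they make
sets of products with plateaus directed.\<close>

lemma prec_mult_E:
  assumes vw: "v \<lless> w" and w: "w \<in> S" and ef: "e \<in> E" "f \<in> E" "star e = e" "f * e = f"
  shows "v * f \<lless> w * e"
proof (rule precI)
  have "v * f * star (w * e) = v * (f * e) * star w" by (simp add: star_mult ef(3) mult.assoc)
  then show "v * f * star (w * e) \<in> E"
    using precD(1)[OF prec_mult_E_left[OF vw w ef(2)]] ef by simp
  have "v * f * sq (w * e) = v * (f * e) * sq w * e" by (simp add: star_mult ef(3) mult.assoc)
  also have "\<dots> = v * (f * sq w) * e" using ef by (simp add: mult.assoc)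
  also have "\<dots> = (v * sq w) * (f * e)" 
    unfolding sq_comm_E[OF w ef(2), symmetric] by (simp add: mult.assoc)
  finally show "v * f * sq (w * e) = v * f" using ef precD[OF vw] by simp
qed

lemma mult_prec_self:
  assumes a: "a \<in> S" and e: "e \<in> E" "e * sq a = e"
  shows "a * e \<lless> a"
  using a e E_conj' by (intro precI) (simp_all add: mult.assoc)

lemma mult_prec_mult:
  assumes a: "a \<in> S" and ef: "e \<in> E" "f \<in> E" "star e = e" "f * e = f" "f * sq a = f"
  shows "a * f \<lless> a * e"
proof (rule precI)
  have "a * f * star (a * e) = a * (f * e) * star a" by (simp add: star_mult ef(3) mult.assoc)
  then show "a * f * star (a * e) \<in> E" using E_conj' a ef by simp
  have "a * f * sq (a * e) = a * ((f * e) * sq a) * e" by (simp add: star_mult ef(3) mult.assoc)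
  then show "a * f * sq (a * e) = a * f" using ef by (simp add: mult.assoc)
qed

lemma filter_subset: "weyl_filter S E U \<Longrightarrow> U \<subseteq> S"
  and filter_nonempty: "weyl_filter S E U \<Longrightarrow> U \<noteq> {}"
  by (simp_all add: weyl_filter_def)

lemma filter_lower:
  assumes "weyl_filter S E U" "a \<in> U" "b \<in> U"
  shows "\<exists>c\<in>U. c \<lless> a \<and> c \<lless> b"
  using assms filter_subset[OF assms(1)] unfolding weyl_filter_def by blast

lemma filter_upward:
  assumes U: "weyl_filter S E U" and a: "a \<in> U" "a \<lless> b" and b: "b \<in> S"
  shows "b \<in> U"
proof -
  have "b \<in> U \<and> b \<in> U \<longleftrightarrow> (\<exists>c\<in>U. c \<lless> b \<and> c \<lless> b)"
    using U b unfolding weyl_filter_def by blast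
  with a show ?thesis by blast
qed

lemma filter_finite_lower:
  assumes U: "weyl_filter S E U" and "finite F" "F \<subseteq> U"
  shows "\<exists>c\<in>U. \<forall>f\<in>F. c \<lless> f"
  using assms(2,3)
proof (induction F rule: finite_induct)
  case empty then show ?case using filter_nonempty[OF U] by auto
next
  case (insert x F)
  then obtain c where "c \<in> U" "\<forall>f\<in>F. c \<lless> f" by auto
  moreover obtain d where "d \<in> U" "d \<lless> c" "d \<lless> x"
    using filter_lower[OF U] insert.prems \<open>c \<in> U\<close> by blast
  ultimately show ?case using prec_trans by blast
qed

lemma filter_improper: "weyl_filter S E U \<Longrightarrow> 0 \<in> U \<longleftrightarrow> U = S"
  using filter_upward[of U 0] zero_prec filter_subset[of U] S_zero by blast

lemma ultrafilter_filter: "weyl_ultrafilter S E U \<Longrightarrow> weyl_filter S E U"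
  by (simp add: weyl_ultrafilter_def)

lemma ultrafilter_zero: "weyl_ultrafilter S E U \<Longrightarrow> 0 \<notin> U"
  using filter_improper[of U] by (simp add: weyl_ultrafilter_def)

lemma ultrafilter_maximal:
  "weyl_ultrafilter S E U \<Longrightarrow> weyl_filter S E V \<Longrightarrow> 0 \<notin> V \<Longrightarrow> U \<subseteq> V \<Longrightarrow> V = U"
  using filter_improper[of V] by (auto simp: weyl_ultrafilter_def)

text \<open>The only element dominated by \<open>0\<close> is \<open>0\<close>, so the upward closure of \<open>T\<close> avoids \<open>0\<close> along with \<open>T\<close>.\<close>

lemma generated_filter:
  assumes T: "T \<noteq> {}" "0 \<notin> T"
    and directed: "\<And>x y. x \<in> T \<Longrightarrow> y \<in> T \<Longrightarrow> \<exists>z\<in>T. z \<lless> x \<and> z \<lless> y"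
    and TS: "T \<subseteq> S"
  defines "G \<equiv> {s \<in> S. \<exists>t\<in>T. t \<lless> s}"
  shows "weyl_filter S E G" "0 \<notin> G" "T \<subseteq> G"
proof -
  show TG: "T \<subseteq> G" using directed TS by (fastforce simp: G_def)
  show "0 \<notin> G" using T prec_zero by (auto simp: G_def)
  have 1: "a \<in> G \<and> b \<in> G" if "a \<in> S" "b \<in> S" "c \<in> G" "c \<lless> a" "c \<lless> b" for a b c
    using that prec_trans unfolding G_def by blast
  have 2: "\<exists>c\<in>G. c \<lless> a \<and> c \<lless> b" if ab: "a \<in> G" "b \<in> G" for a b
  proof -
    obtain x y where xy: "x \<in> T" "y \<in> T" "x \<lless> a" "y \<lless> b" using ab by (auto simp: G_def)
    then obtain z where "z \<in> T" "z \<lless> x" "z \<lless> y" using directed by blast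
    with xy TG show ?thesis using prec_trans by blast
  qed
  show "weyl_filter S E G"
    unfolding weyl_filter_def
  proof (intro conjI ballI iffI)
    show "G \<noteq> {}" using TG T by blast
    show "G \<subseteq> S" by (auto simp: G_def)
    fix a b assume ab: "a \<in> S" "b \<in> S"
    show "\<exists>c\<in>G. c \<lless> a \<and> c \<lless> b" if "a \<in> G \<and> b \<in> G" using 2 that by blast
    show "a \<in> G" "b \<in> G" if "\<exists>c\<in>G. c \<lless> a \<and> c \<lless> b" using 1[OF ab] that by blast+
  qed
qed

lemma filter_in_ultrafilter:
  assumes G: "weyl_filter S E G" "0 \<notin> G"
  shows "\<exists>V. weyl_ultrafilter S E V \<and> G \<subseteq> V"
proof -
  let ?A = "{V. weyl_filter S E V \<and> 0 \<notin> V \<and> G \<subseteq> V}"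
  have "\<exists>M\<in>?A. \<forall>X\<in>?A. M \<subseteq> X \<longrightarrow> X = M"
  proof (rule subset_Zorn_nonempty)
    show "?A \<noteq> {}" using G by blast
    fix \<C> assume C: "\<C> \<noteq> {}" "subset.chain ?A \<C>"
    then have sub: "\<C> \<subseteq> ?A" and lin: "\<And>X Y. X \<in> \<C> \<Longrightarrow> Y \<in> \<C> \<Longrightarrow> X \<subseteq> Y \<or> Y \<subseteq> X"
      by (auto simp: subset_chain_def)
    have "weyl_filter S E (\<Union>\<C>)"
      unfolding weyl_filter_def
    proof (intro conjI ballI iffI)
      obtain X where "X \<in> \<C>" using C by blast
      then show "\<Union>\<C> \<noteq> {}" using sub filter_nonempty[of X] by blast
      show "\<Union>\<C> \<subseteq> S" using sub filter_subset by blast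
    next
      fix a b assume "a \<in> \<Union>\<C> \<and> b \<in> \<Union>\<C>"
      then obtain X where X: "X \<in> \<C>" "a \<in> X" "b \<in> X" using lin by blast
      then have "\<exists>c\<in>X. c \<lless> a \<and> c \<lless> b" using sub by (intro filter_lower) auto
      then show "\<exists>c\<in>\<Union>\<C>. c \<lless> a \<and> c \<lless> b" using X by blast
    next
      fix a b assume "a \<in> S" "b \<in> S" "\<exists>c\<in>\<Union>\<C>. c \<lless> a \<and> c \<lless> b"
      then obtain X c where X: "X \<in> \<C>" "c \<in> X" "c \<lless> a" "c \<lless> b" by blast
      then have "weyl_filter S E X" using sub by blast
      then show "a \<in> \<Union>\<C>" "b \<in> \<Union>\<C>"
        using X \<open>a \<in> S\<close> \<open>b \<in> S\<close> filter_upward by blast+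
    qed
    then show "\<Union>\<C> \<in> ?A" using C sub by blast
  qed
  then obtain V where V: "weyl_filter S E V" "0 \<notin> V" "G \<subseteq> V"
    and max: "\<forall>X\<in>?A. V \<subseteq> X \<longrightarrow> X = V" by (elim bexE CollectE conjE)
  have "weyl_ultrafilter S E V"
    unfolding weyl_ultrafilter_def
  proof (intro conjI allI impI)
    show "weyl_filter S E V" by (rule V(1))
    show "V \<noteq> S" using V filter_improper by blast
    fix X assume X: "weyl_filter S E X \<and> X \<noteq> S \<and> V \<subseteq> X"
    then have "X \<in> ?A" using V filter_improper[of X] by auto
    then show "X = V" using max X by blast
  qed
  then show ?thesis using V by blast
qed

lemma weyl_basic_mono: "a \<lless> b \<Longrightarrow> b \<in> S \<Longrightarrow> weyl_basic S E a \<subseteq> weyl_basic S E b"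
  unfolding weyl_basic_def by (blast intro: filter_upward dest: ultrafilter_filter)

lemma openin_weyl_basic:
  assumes "openin (weyl_groupoid S E) W" "U \<in> W"
  shows "\<exists>a\<in>S. U \<in> weyl_basic S E a \<and> weyl_basic S E a \<subseteq> W"
proof -
  obtain B where "B \<subseteq> S" "W = (\<Union>a\<in>B. weyl_basic S E a)"
    using assms(1) unfolding openin_weyl_groupoid by (elim exE conjE)
  moreover from this assms(2) obtain a where "a \<in> B" "U \<in> weyl_basic S E a" by auto
  ultimately show ?thesis by blast
qed

end

section \<open>Plateaus in the semigroup and separation of ultrafilters\<close>

locale weyl_lattice = weyl_semigroup S E + lattice_ordered_subring L
  for S E L :: "'a::star_ring set" +
  assumes hered: "hereditary S L"
    and sq_contraction: "s \<in> S \<Longrightarrow> contraction (sq s)"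
begin

lemma sq_L: "s \<in> S \<Longrightarrow> sq s \<in> L"
  using contractionD(1)[OF sq_contraction] .

text \<open>This is how elements built by lattice operations in \<open>L\<close> become members of the semigroup.\<close>

lemma hereditary_in_S: "x \<in> L \<Longrightarrow> 0 \<unlhd> x \<Longrightarrow> s \<in> S \<Longrightarrow> 0 \<unlhd> sq s - x \<Longrightarrow> x \<in> S"
  using hered star_le_iff_diff[of x "sq s"] by (auto simp: hereditary_def positive_part_def)

lemma mult_self_adjoint_zero:
  assumes "star y = y" "x * (y * y) = 0"
  shows "x * y = (0::'a)"
proof -
  have "(x * y) * star (x * y) = x * (y * y) * star x" by (simp add: star_mult assms(1) mult.assoc)
  then show ?thesis using proper assms(2) unfolding star_proper_def by (metis mult_zero_left)
qed

lemma sq_mult_self_adjoint_zero: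
  assumes "star y = y" "sq x * y = 0"
  shows "x * y = (0::'a)"
proof -
  have "sq (x * y) = y * (sq x * y)" by (simp add: star_mult assms(1) mult.assoc)
  then show ?thesis using assms(2) sq_eq_zero_iff[OF proper, of "x * y"] by simp
qed

end

text \<open>The setting of one pair \<open>t \<lless> s\<close>. Below, \<open>gap\<close> plays the role of \<open>1 - q\<close> for \<open>q = t\<^sup>* t\<close>; the heights
\<open>n\<close> times \<open>gap\<close> yield plateaus that shrink towards the set where \<open>q = 1\<close>.\<close>

locale plateau_family = weyl_lattice S E L for S E L :: "'a::star_ring set" +
  fixes s t :: 'a
  assumes s: "s \<in> S" and t: "t \<in> S" and ts: "t \<lless> s"
begin

abbreviation "u \<equiv> sq s"
abbreviation "gap \<equiv> sq s - sq t"
abbreviation "pl h \<equiv> plateau (sq s) h"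

lemma sq_s: "contraction u" "u \<in> L" "0 \<unlhd> u"
  using sq_contraction[OF s] contractionD by blast+

lemma sq_t: "sq t \<in> L" "0 \<unlhd> sq t" "sq t * u = sq t"
  using sq_L[OF t] sq_nonneg[of t] prec_sq[OF ts] by auto

lemma gap_nonneg: "gap \<in> L" "0 \<unlhd> gap"
proof -
  show "gap \<in> L" using sq_s sq_t by (simp add: L_closed)
  have "sq t * sq s = sq t" by (rule prec_sq[OF ts])
  then show "0 \<unlhd> gap"
    using contractionD(3)[OF sq_contraction[OF t] sq_s(2,3)] by simp
qed

definition heights :: "'a set" where
  "heights = {h \<in> L. 0 \<unlhd> h - gap}"

lemma heightsD: "h \<in> heights \<Longrightarrow> h \<in> L" "h \<in> heights \<Longrightarrow> 0 \<unlhd> h"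
  "h \<in> heights \<Longrightarrow> 0 \<unlhd> h - gap"
proof -
  assume h: "h \<in> heights"
  have "h = (h - gap) + gap" by simp
  with h gap_nonneg show "0 \<unlhd> h" unfolding heights_def by (metis (mono_tags, lifting) mem_Collect_eq star_nonneg_add)
qed (simp_all add: heights_def)

lemma heights_add: "h \<in> heights \<Longrightarrow> z \<in> L \<Longrightarrow> 0 \<unlhd> z \<Longrightarrow> h + z \<in> heights"
proof -
  assume h: "h \<in> heights" and z: "z \<in> L" "0 \<unlhd> z"
  have "h + z - gap = (h - gap) + z" by simp
  then have "0 \<unlhd> h + z - gap" using heightsD(3)[OF h] z(2) by (simp only: star_nonneg_add)
  then show ?thesis using heightsD(1)[OF h] z by (simp add: heights_def L_closed)
qed

lemma gap_heights: "n > 0 \<Longrightarrow> nmul n gap \<in> heights"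
proof -
  assume "n > 0"
  then obtain m where n: "n = Suc m" using gr0_implies_Suc by blast
  have "nmul n gap - gap = nmul m gap" by (simp add: n nmul_Suc)
  then show ?thesis using gap_nonneg by (simp only: heights_def mem_Collect_eq L_nmul star_nonneg_nmul simp_thms)
qed

context
  fixes h assumes h: "h \<in> heights"
begin

lemma pl_L: "pl h \<in> L" and pl_nonneg: "0 \<unlhd> pl h" and pl_S: "pl h \<in> S"
proof -
  show 1: "pl h \<in> L" and 2: "0 \<unlhd> pl h" 
    using plateau_in[OF sq_s(1)] plateau_nonneg[OF sq_s(1)] heightsD[OF h] by blast+
  show "pl h \<in> S"
    using hereditary_in_S[OF 1 2 s] plateau_le[OF sq_s(1)] heightsD[OF h] by blast
qed

lemma pl_self_adjoint: "star (pl h) = pl h"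
  using nonneg_self_adjoint[OF pl_nonneg] .

lemma pl_sq_E: "pl h * pl h \<in> E"
  using sq_in_E[OF pl_S] by (simp add: pl_self_adjoint)

lemma pl_sq_self_adjoint: "star (pl h * pl h) = pl h * pl h"
  by (simp add: star_mult pl_self_adjoint)

lemma pl_unit: "pl h * u = pl h"
  using plateau_unit[OF sq_s(1)] heightsD[OF h] sq_t by blast

lemma pl_absorb:
  assumes "h' \<in> L" "0 \<unlhd> h' - (h + h)"
  shows "pl h' * pl h = pl h'"
  using plateau_mult_absorb[OF sq_s(1) sq_t] heightsD[OF h] assms by blast

lemma pl_unit_above:
  assumes "s \<lless> a" shows "pl h * sq a = pl h"
proof -
  have "pl h * sq a = pl h * u * sq a" by (simp only: pl_unit)
  also have "\<dots> = pl h * (u * sq a)" by (simp only: mult.assoc)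
  finally show ?thesis using prec_sq[OF assms] pl_unit by simp
qed

end

lemma pl_sq_absorb:
  assumes "h \<in> heights" "h' \<in> heights" "0 \<unlhd> h' - (h + h)"
  shows "(pl h' * pl h') * (pl h * pl h) = pl h' * pl h'"
proof -
  have "pl h' * pl h = pl h'" using assms pl_absorb heightsD by blast
  then show ?thesis by (metis mult.assoc)
qed

lemma pl_one_below:
  assumes "b \<lless> t" "b \<in> S"
  shows "sq b * pl (nmul n gap) = sq b"
proof (rule plateau_eq_one[OF sq_s(1)])
  have "sq b * gap = 0"
    using prec_sq[OF assms(1)] prec_sq[OF prec_trans[OF assms(1) ts]]
    by (simp add: right_diff_distrib)
  then show "sq b * nmul n gap = 0" by (simp add: nmul_mult_right)
  show "sq b * u = sq b" using prec_sq[OF prec_trans[OF assms(1) ts]] .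
qed (use gap_nonneg sq_L[OF assms(2)] sq_nonneg in \<open>auto simp: L_nmul star_nonneg_nmul\<close>)

lemma mult_pl_one_below:
  assumes "b \<lless> t" "b \<in> S" "c \<lless> b"
  shows "c * pl (nmul n gap) = c"
  using pl_one_below[OF assms(1,2), of n] precD(2)[OF assms(3)] by (metis mult.assoc)

lemma nmul_gap_double:
  "0 \<unlhd> nmul (2 * (m + n)) gap - (nmul n gap + nmul n gap)"
proof -
  have "2 * (m + n) = (n + n) + (m + m)" by simp
  then have "nmul (2 * (m + n)) gap - (nmul n gap + nmul n gap) = nmul (m + m) gap"
    by (simp only: nmul_add) simp
  then show ?thesis using gap_nonneg by (simp only: star_nonneg_nmul)
qed

end

context weyl_lattice begin

text \<open>If no \<open>v \<in> V\<close> is orthogonal to \<open>c\<close>, then \<open>V\<close> can be enlarged by plateaus that are \<open>1\<close> on \<open>c\<close> and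
supported in \<open>s\<close>. The products \<open>v y\<^sub>n\<^sup>2\<close> with \<open>v \<in> V\<close> and \<open>y\<^sub>n\<close> the plateau of \<open>n\<close> times \<open>gap\<close> form
a directed set without \<open>0\<close>; the filter that they generate contains \<open>V\<close> and \<open>s\<close>, contrary to
maximality. The interpolating \<open>t\<close> is what leaves room for infinitely many plateaus, each dominating
the next, between \<open>c\<close> and \<open>s\<close>.\<close>

lemma ultrafilter_separation:
  assumes V: "weyl_ultrafilter S E V" and a: "a \<in> V"
    and S: "c \<in> S" "t \<in> S" "s \<in> S" and prec: "c \<lless> t" "t \<lless> s" "s \<lless> a" and nV: "s \<notin> V"
  shows "\<exists>v\<in>V. v * sq c = 0"
proof (rule ccontr)
  assume nz: "\<not> ?thesis"
  interpret plateau_family S E L s t using S prec by unfold_locales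
  note VF = ultrafilter_filter[OF V]
  have aS: "a \<in> S" using a filter_subset[OF VF] by blast
  define y where "y n = pl (nmul n gap)" for n
  define T where "T = {v * (y n * y n) | v n. v \<in> V \<and> v \<lless> a \<and> n > 0}"
  have yE: "y n * y n \<in> E" "star (y n * y n) = y n * y n" "star (y n) = y n" if "n > 0" for n
    using pl_sq_E pl_sq_self_adjoint pl_self_adjoint gap_heights[OF that] by (simp_all add: y_def)
  have T_le: "\<exists>x\<in>T. x \<lless> v" if vV: "v \<in> V" for v
  proof -
    obtain w where w: "w \<in> V" "w \<lless> v" "w \<lless> a" using filter_lower[OF VF vV a] by blast
    then have "w * (y 1 * y 1) \<in> T" unfolding T_def using zero_less_one by blast
    moreover have "w * (y 1 * y 1) \<lless> v"
      using w yE(1)[of 1] vV filter_subset[OF VF] by (intro prec_mult_E_left) auto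
    ultimately show ?thesis by blast
  qed
  have T1: "T \<noteq> {}" using T_le[OF a] by blast
  have T2: "0 \<notin> T"
  proof
    assume "0 \<in> T"
    then obtain v n where v: "v \<in> V" "n > 0" "v * (y n * y n) = 0" unfolding T_def by force
    then have "v * y n = 0" using mult_self_adjoint_zero yE by blast
    moreover have "sq c = y n * sq c"
      using pl_one_below[OF prec(1) S(1), of n] pl_L[OF gap_heights[OF v(2)]]
        L_comm[OF sq_L[OF S(1)]] by (simp add: y_def)
    ultimately have "v * sq c = 0" by (metis mult.assoc mult_zero_left)
    then show False using nz v by blast
  qed
  have T3: "\<exists>z\<in>T. z \<lless> x1 \<and> z \<lless> x2" if x: "x1 \<in> T" "x2 \<in> T" for x1 x2
  proof -
    obtain v n w m where 1: "x1 = v * (y n * y n)" "v \<in> V" "n > 0"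
      "x2 = w * (y m * y m)" "w \<in> V" "m > 0" using x unfolding T_def by blast
    obtain z where "z \<in> V" "z \<lless> v" "z \<lless> w" using filter_lower[OF VF 1(2,5)] by blast
    moreover obtain z' where z': "z' \<in> V" "z' \<lless> z" "z' \<lless> a"
      using filter_lower[OF VF \<open>z \<in> V\<close> a] by blast
    ultimately have zz: "z' \<lless> v" "z' \<lless> w" using prec_trans by blast+
    \<comment> \<open>The height of the lower bound must be at least twice each of the two given heights.\<close>
    let ?k = "2 * (n + m)"
    have k: "?k > 0" "?k = 2 * (m + n)" using 1 by auto
    have "z' * (y ?k * y ?k) \<in> T" unfolding T_def using z' k(1) by blast
    moreover have "z' * (y ?k * y ?k) \<lless> x2"
      unfolding 1 y_def using 1 k zz filter_subset[OF VF] yE[unfolded y_def] nmul_gap_double[of n m]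
      by (intro prec_mult_E pl_sq_absorb gap_heights) auto
    moreover have "z' * (y ?k * y ?k) \<lless> x1"
      unfolding 1 k(2) y_def using 1 k zz filter_subset[OF VF] yE[unfolded y_def] nmul_gap_double[of m n]
      by (intro prec_mult_E pl_sq_absorb gap_heights) auto
    ultimately show ?thesis by blast
  qed
  have T4: "T \<subseteq> S" 
    unfolding T_def using yE(1) filter_subset[OF VF] S_mult E_sub by blast
  define G where "G = {s \<in> S. \<exists>t\<in>T. t \<lless> s}"
  note gen = generated_filter[OF T1 T2 T3 T4, folded G_def]
  have "V \<subseteq> G" using T_le filter_subset[OF VF] by (auto simp: G_def)
  then have "G = V" using ultrafilter_maximal[OF V gen(1,2)] by blast
  moreover have "s \<in> G"
  proof -
    obtain x where "x \<in> T" using T1 by blast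
    then obtain v n where v: "x = v * (y n * y n)" "v \<in> V" "v \<lless> a" "n > 0" unfolding T_def by blast
    have "x \<lless> s"
    proof (rule precI)
      have sa: "sq a * star s = star s"
        using arg_cong[OF precD(2)[OF prec(3)], of star] by (simp add: star_mult star_star mult.assoc)
      have "x * star s = v * sq a * (y n * y n) * (sq a * star s)"
        by (simp only: v(1) precD(2)[OF v(3)] sa)
      also have "\<dots> = (v * star a) * (a * (y n * y n) * star a) * star (s * star a)"
        by (simp add: star_mult star_star mult.assoc)
      finally show "x * star s \<in> E"
        using precD(1)[OF v(3)] precD(1)[OF prec(3)] yE[OF v(4)] aS
        by (simp add: E_mult E_conj' E_star)
      have "y n * u = y n" unfolding y_def using pl_unit gap_heights v(4) by blast
      then show "x * sq s = x" unfolding v(1) by (simp add: mult.assoc)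
    qed
    then show ?thesis using \<open>x \<in> T\<close> S by (auto simp: G_def)
  qed
  ultimately show False using nV by simp
qed

end

section \<open>Compact neighbourhoods\<close>

context plateau_family begin

text \<open>An ultrafilter belongs to the core if it contains \<open>a\<close> and cannot be separated from the set where
\<open>q = 1\<close>: that set is the intersection of the sets where \<open>n (u - q) < 1\<close>, and \<open>plateau u (n (u - q))\<close> is
nonzero exactly where \<open>n (u - q) < 1\<close>.\<close>

definition core :: "'a \<Rightarrow> 'a set set" where
  "core a = {V. weyl_ultrafilter S E V \<and> a \<in> V \<and> (\<forall>v\<in>V. \<forall>n>0. v * pl (nmul n gap) \<noteq> 0)}"

text \<open>Every plateau acts as a unit on the elements below \<open>b\<close>, because \<open>q\<close> is a unit on \<open>b\<close>.\<close>

lemma weyl_basic_subset_core: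
  assumes b: "b \<in> S" "b \<lless> t" and a: "a \<in> S" "s \<lless> a"
  shows "weyl_basic S E b \<subseteq> core a"
proof
  fix V assume "V \<in> weyl_basic S E b"
  then have V: "weyl_ultrafilter S E V" "b \<in> V" by (auto simp: weyl_basic_def)
  note VF = ultrafilter_filter[OF V(1)]
  have "b \<lless> a" using prec_trans[OF prec_trans[OF b(2) ts] a(2)] .
  then have "a \<in> V" using filter_upward[OF VF V(2)] a by blast
  moreover have "v * pl (nmul n gap) \<noteq> 0" if v: "v \<in> V" for v n
  proof
    assume 0: "v * pl (nmul n gap) = 0"
    obtain c where c: "c \<in> V" "c \<lless> v" "c \<lless> b" using filter_lower[OF VF v V(2)] by blast
    have "c = c * pl (nmul n gap)" using mult_pl_one_below[OF b(2,1) c(3)] by simp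
    also have "\<dots> = c * star v * (v * pl (nmul n gap))"
      by (rule prec_factor[OF c(2)])
    finally show False using 0 c(1) ultrafilter_zero[OF V(1)] by simp
  qed
  ultimately show "V \<in> core a" using V(1) by (simp add: core_def)
qed

text \<open>The set \<open>C\<close> collects elements that lie two domination steps below an element whose basic set is
contained in a member of the cover; the two steps are the room that \<open>ultrafilter_separation\<close>
needs. The heights \<open>M\<close> measure how far a point is from the core and how much of \<open>C\<close> is present
there, so plateaus of large heights look for points of the core outside \<open>C\<close>. Either all of them
are nonzero, and such a point exists although \<open>C\<close> meets every point of the core, or one of them vanishes and bounds \<open>u\<close> by finitely many
elements of \<open>C\<close>.\<close>

lemma compactin_core:
  assumes a: "a \<in> S" "s \<lless> a"
  shows "compactin (weyl_groupoid S E) (core a)"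
  unfolding compactin_def
proof (intro conjI allI impI)
  show "core a \<subseteq> topspace (weyl_groupoid S E)"
    by (auto simp: core_def topspace_weyl_groupoid)
  fix \<W> assume W: "Ball \<W> (openin (weyl_groupoid S E)) \<and> core a \<subseteq> \<Union>\<W>"
  define C where "C = {c \<in> S. \<exists>c1\<in>S. \<exists>c2\<in>S. \<exists>W\<in>\<W>. c \<lless> c1 \<and> c1 \<lless> c2 \<and> c2 \<lless> a \<and> weyl_basic S E c2 \<subseteq> W}"
  have C_meets: "\<exists>c\<in>C. c \<in> V" if Vc: "V \<in> core a" for V
  proof -
    have V: "weyl_filter S E V" "a \<in> V" "weyl_ultrafilter S E V"
      using Vc ultrafilter_filter by (auto simp: core_def)
    obtain W' where W': "W' \<in> \<W>" "V \<in> W'" using Vc W by blast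
    then obtain r where r: "r \<in> S" "V \<in> weyl_basic S E r" "weyl_basic S E r \<subseteq> W'"
      using W openin_weyl_basic by blast
    then have "r \<in> V" by (simp add: weyl_basic_def)
    then obtain c2 where c2: "c2 \<in> V" "c2 \<lless> r" "c2 \<lless> a" using filter_lower[OF V(1) _ V(2)] by blast
    then obtain c1 where c1: "c1 \<in> V" "c1 \<lless> c2" using filter_lower[OF V(1)] by blast
    then obtain c where c: "c \<in> V" "c \<lless> c1" using filter_lower[OF V(1)] by blast
    have "weyl_basic S E c2 \<subseteq> W'" using weyl_basic_mono[OF c2(2) r(1)] r(3) by blast
    moreover have "c \<in> S" "c1 \<in> S" "c2 \<in> S" using c c1 c2 filter_subset[OF V(1)] by blast+
    ultimately have "c \<in> C" unfolding C_def using c c1 c2 W' by blast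
    then show ?thesis using c by blast
  qed
  have CS: "C \<subseteq> S" by (auto simp: C_def)
  define Z where "Z = {sum_list (map sq cs) | cs. set cs \<subseteq> C}"
  have Z: "z \<in> L \<and> 0 \<unlhd> z" if "z \<in> Z" for z
  proof -
    obtain cs where cs: "z = sum_list (map sq cs)" "set cs \<subseteq> S" using \<open>z \<in> Z\<close> CS by (auto simp: Z_def)
    show ?thesis unfolding cs(1) using cs(2)
      by (induction cs) (auto simp: star_nonneg_0 L_add star_nonneg_add sq_nonneg sq_L)
  qed
  have Z_add: "z1 + z2 \<in> Z" if z: "z1 \<in> Z" "z2 \<in> Z" for z1 z2
  proof -
    obtain cs ds where "z1 = sum_list (map sq cs)" "z2 = sum_list (map sq ds)" 
      "set cs \<subseteq> C" "set ds \<subseteq> C" using z by (auto simp: Z_def)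
    then show ?thesis unfolding Z_def by (intro CollectI exI[of _ "cs @ ds"]) auto
  qed
  have Z0: "0 \<in> Z" unfolding Z_def by (intro CollectI exI[of _ "[]"]) auto
  define M where "M = {nmul n gap + z | n z. n > 0 \<and> z \<in> Z}"
  have MH: "h \<in> heights" if "h \<in> M" for h
    using that Z unfolding M_def by (auto intro!: heights_add gap_heights)
  have M_add: "h1 + h2 \<in> M" if h: "h1 \<in> M" "h2 \<in> M" for h1 h2
  proof -
    obtain n z m w where "h1 = nmul n gap + z" "h2 = nmul m gap + w" "n > 0" "z \<in> Z" "w \<in> Z"
      using h by (auto simp: M_def)
    then show ?thesis unfolding M_def
      by (intro CollectI exI[of _ "n + m"] exI[of _ "z + w"]) (simp add: nmul_add Z_add)
  qed
  define T where "T = {a * (pl h * pl h) | h. h \<in> M}"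
  have pla: "pl h * pl h * sq a = pl h * pl h" if "h \<in> M" for h
    using pl_unit_above[OF MH[OF that] a(2)] by (simp add: mult.assoc)
  have T_dir: "a * (pl h' * pl h') \<lless> a * (pl h * pl h)"
    if h: "h \<in> M" "h' \<in> M" "0 \<unlhd> h' - (h + h)" for h h'
    using h MH pla a by (intro mult_prec_mult pl_sq_E pl_sq_self_adjoint pl_sq_absorb) auto
  show "\<exists>\<F>. finite \<F> \<and> \<F> \<subseteq> \<W> \<and> core a \<subseteq> \<Union>\<F>"
  proof (cases "0 \<in> T")
    case False
    have M0: "nmul n gap \<in> M" if "n > 0" for n
      unfolding M_def using that Z0 by (intro CollectI exI[of _ n] exI[of _ 0]) auto
    have T1: "T \<noteq> {}" using M0[of 1] by (auto simp: T_def)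
    have T3: "\<exists>z\<in>T. z \<lless> x1 \<and> z \<lless> x2" if x: "x1 \<in> T" "x2 \<in> T" for x1 x2
    proof -
      obtain h1 h2 where h: "x1 = a * (pl h1 * pl h1)" "x2 = a * (pl h2 * pl h2)" "h1 \<in> M" "h2 \<in> M"
        using x by (auto simp: T_def)
      let ?h = "(h1 + h2) + (h1 + h2)"
      have hM: "?h \<in> M" using h M_add by blast
      have "0 \<unlhd> ?h - (h1 + h1)" "0 \<unlhd> ?h - (h2 + h2)"
        using heightsD(2)[OF MH] h by (simp_all add: algebra_simps star_nonneg_add)
      then have "a * (pl ?h * pl ?h) \<lless> x1" "a * (pl ?h * pl ?h) \<lless> x2"
        unfolding h(1,2) using T_dir[OF h(3) hM] T_dir[OF h(4) hM] by blast+
      moreover have "a * (pl ?h * pl ?h) \<in> T" unfolding T_def using hM by blast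
      ultimately show ?thesis by blast
    qed
    have T4: "T \<subseteq> S"
      using S_mult[OF a(1) E_sub[OF pl_sq_E[OF MH]]] by (auto simp: T_def)
    note gen = generated_filter[OF T1 False T3 T4]
    obtain V where V: "weyl_ultrafilter S E V" and TV: "T \<subseteq> V"
      using filter_in_ultrafilter[OF gen(1,2)] gen(3) by blast
    note VF = ultrafilter_filter[OF V]
    \<comment> \<open>An element below the plateau of \<open>2 h\<close> sees the plateau of \<open>h\<close> as a unit; for this reason the
      element of \<open>V\<close> used below always comes from the doubled height.\<close>
    have absorbed: "z * pl h = z" if "h \<in> M" "z \<lless> a * (pl (h + h) * pl (h + h))" for h z
    proof -
      let ?x = "a * (pl (h + h) * pl (h + h))"
      have "pl (h + h) * pl h = pl (h + h)"
        using that(1) MH heightsD M_add star_nonneg_0 by (intro pl_absorb) auto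
      then have x: "?x * pl h = ?x" by (simp add: mult.assoc)
      have "z * pl h = z * star ?x * (?x * pl h)"
        using prec_factor[OF that(2)] .
      then show ?thesis using precD(2)[OF that(2)] x by (simp add: mult.assoc)
    qed
    have TV': "a * (pl (h + h) * pl (h + h)) \<in> V" if "h \<in> M" for h
      using TV that M_add by (auto simp: T_def)
    have "a \<in> V"
    proof -
      have "a * (pl gap * pl gap) \<lless> a"
        using a M0[of 1] pla[of gap] MH[of gap]
        by (intro mult_prec_self pl_sq_E) (auto simp: nmul_Suc)
      moreover have "a * (pl gap * pl gap) \<in> V" using TV M0[of 1] by (auto simp: T_def nmul_Suc)
      ultimately show ?thesis using filter_upward[OF VF] a by blast
    qed
    moreover have "v * pl (nmul n gap) \<noteq> 0" if v: "v \<in> V" and n: "n > 0" for v n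
    proof
      let ?h = "nmul n gap"
      assume 0: "v * pl ?h = 0"
      obtain z where z: "z \<in> V" "z \<lless> v" "z \<lless> a * (pl (?h + ?h) * pl (?h + ?h))"
        using filter_lower[OF VF v TV'[OF M0[OF n]]] by blast
      have "z = z * pl ?h" using absorbed[OF M0[OF n] z(3)] by simp
      also have "\<dots> = z * star v * (v * pl ?h)" by (rule prec_factor[OF z(2)])
      finally show False using 0 z(1) ultrafilter_zero[OF V] by simp
    qed
    ultimately have "V \<in> core a" using V by (simp add: core_def)
    then obtain c where c: "c \<in> C" "c \<in> V" using C_meets by blast
    have cL: "contraction (sq c)" "sq c \<in> L" "0 \<unlhd> sq c" 
      using c CS sq_contraction sq_L sq_nonneg by blast+
    \<comment> \<open>Near \<open>c\<close> this height is at least \<open>1\<close>, so its plateau vanishes there, although it should be a unit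
      on the common lower bound \<open>z\<close>.\<close>
    define h where "h = gap + sq c"
    have "sq c \<in> Z" unfolding Z_def using c by (intro CollectI exI[of _ "[c]"]) auto
    then have hM: "h \<in> M" unfolding h_def M_def
      by (intro CollectI exI[of _ 1] exI[of _ "sq c"]) (auto simp: nmul_Suc)
    note hD = heightsD[OF MH[OF hM]]
    obtain z where z: "z \<in> V" "z \<lless> c" "z \<lless> a * (pl (h + h) * pl (h + h))"
      using filter_lower[OF VF c(2) TV'[OF hM]] by blast
    have zS: "z \<in> S" using z filter_subset[OF VF] by blast
    have zp: "sq z * pl h = sq z" using absorbed[OF hM z(3)] by (simp add: mult.assoc)
    have "sq z * u = sq z * pl h * u" by (simp only: zp)
    also have "\<dots> = sq z * (pl h * u)" by (simp only: mult.assoc)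
    also have "\<dots> = sq z" by (simp only: pl_unit[OF MH[OF hM]] zp)
    finally have "sq z * (u - sq c) = 0" using prec_sq[OF z(2)] by (simp add: right_diff_distrib)
    then have "sq z * pl h = 0"
      using sq_s cL hD zS sq_L sq_nonneg gap_nonneg star_nonneg_0
      by (intro mult_plateau_zero[of u h "u - sq c" "sq c" 1]) (auto simp: L_diff h_def nmul_Suc)
    then have "z = 0" using zp sq_eq_zero_iff[OF proper, of z] by simp
    then show ?thesis using z ultrafilter_zero[OF V] by simp
  next
    case True
    then obtain h where h: "h \<in> M" "a * (pl h * pl h) = 0" by (auto simp: T_def)
    have "sq a * (pl h * pl h) = 0" using h(2) by (simp add: mult.assoc)
    moreover have "sq a * (pl h * pl h) = pl h * pl h * sq a" 
      using sq_comm_E[OF a(1) pl_sq_E[OF MH[OF h(1)]]] .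
    ultimately have "pl h * pl h = 0" using pla[OF h(1)] by simp
    then have "pl h = 0" using nonneg_square_zero pl_nonneg[OF MH[OF h(1)]] by blast
    then have hu: "0 \<unlhd> h - u" using plateau_zero_imp_le[OF sq_s(1)] heightsD[OF MH[OF h(1)]] by blast
    obtain N cs where N: "h = nmul N gap + sum_list (map sq cs)" "N > 0" "set cs \<subseteq> C"
      using h(1) by (auto simp: M_def Z_def)
    have "\<forall>c\<in>set cs. \<exists>c1 c2 W. c1 \<in> S \<and> c2 \<in> S \<and> W \<in> \<W> \<and> c \<lless> c1 \<and> c1 \<lless> c2 \<and> c2 \<lless> a
        \<and> weyl_basic S E c2 \<subseteq> W"
      using N(3) unfolding C_def by blast
    then obtain c1 c2 W' where cc: "\<And>c. c \<in> set cs \<Longrightarrow> c1 c \<in> S \<and> c2 c \<in> S \<and> W' c \<in> \<W> \<and>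
        c \<lless> c1 c \<and> c1 c \<lless> c2 c \<and> c2 c \<lless> a \<and> weyl_basic S E (c2 c) \<subseteq> W' c"
      by metis
    \<comment> \<open>The relation \<open>u \<le> h\<close> reads \<open>u - N (u - q) \<le> \<Sum> c\<^sup>* c\<close>; the right-hand side vanishes on any \<open>z\<close>
      orthogonal to all \<open>c\<close>, so the plateau of \<open>N (u - q)\<close> vanishes there too.\<close>
    have "core a \<subseteq> \<Union>(W' ` set cs)"
    proof (rule ccontr)
      assume "\<not> ?thesis"
      then obtain V where V: "V \<in> core a" "\<And>c. c \<in> set cs \<Longrightarrow> V \<notin> W' c" by blast
      then have VU: "weyl_ultrafilter S E V" "a \<in> V" by (auto simp: core_def)
      note VF = ultrafilter_filter[OF VU(1)]
      have "\<exists>v\<in>V. v * sq c = 0" if "c \<in> set cs" for c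
      proof -
        have "c2 c \<notin> V" using V(2)[OF that] cc[OF that] VU by (auto simp: weyl_basic_def)
        then show ?thesis
          using ultrafilter_separation[OF VU, of c "c1 c" "c2 c"] cc[OF that] that N(3) CS by blast
      qed
      then obtain f where f: "\<And>c. c \<in> set cs \<Longrightarrow> f c \<in> V \<and> f c * sq c = 0" by metis
      obtain z where z: "z \<in> V" "\<And>c. c \<in> set cs \<Longrightarrow> z \<lless> f c"
        using filter_finite_lower[OF VF, of "f ` set cs"] f by auto
      have zc: "sq z * sq c = 0" if "c \<in> set cs" for c
      proof -
        have "sq z * sq c = star z * (z * star (f c) * (f c * sq c))"
          using prec_factor[OF z(2)[OF that], of "sq c"] by (simp add: mult.assoc)
        then show ?thesis using f[OF that] by simp
      qed
      have "sq z * sum_list (map sq cs) = 0"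
        using zc by (induction cs) (simp_all add: distrib_left)
      then have "sq z * (h - u) = - (sq z * (u - nmul N gap))"
        unfolding N(1) by (simp add: algebra_simps)
      moreover have zL: "sq z \<in> L" using z(1) filter_subset[OF VF] sq_L by blast
      moreover have "0 \<unlhd> sq z * (h - u)"
        using zL L_diff[OF heightsD(1)[OF MH[OF h(1)]] sq_s(2)] sq_nonneg hu by (rule nonneg_mult)
      moreover have "nmul N u - (u - (u - nmul N gap)) = nmul N (sq t)"
        by (simp add: nmul_diff_right)
      ultimately have "sq z * pl (nmul N gap) = 0"
        using sq_s sq_t gap_nonneg sq_nonneg star_nonneg_0
        by (intro mult_plateau_zero[of u _ "u - nmul N gap" u N]) 
          (auto simp: L_closed star_nonneg_nmul)
      then have "z * pl (nmul N gap) = 0"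
        using sq_mult_self_adjoint_zero pl_self_adjoint gap_heights N(2) by blast
      then show False using V(1) z(1) N(2) by (auto simp: core_def)
    qed
    moreover have "W' ` set cs \<subseteq> \<W>" using cc by blast
    ultimately show ?thesis by (intro exI[of _ "W' ` set cs"]) auto
  qed
qed

end

context weyl_lattice begin

theorem weyl_groupoid_locally_compact:
  "neighbourhood_base_of (compactin (weyl_groupoid S E)) (weyl_groupoid S E)"
  unfolding neighbourhood_base_of
proof (intro allI impI, elim conjE)
  fix W U assume W: "openin (weyl_groupoid S E) W" "U \<in> W"
  then obtain a where a: "a \<in> S" "U \<in> weyl_basic S E a" "weyl_basic S E a \<subseteq> W"
    using openin_weyl_basic by blast
  then have U: "weyl_filter S E U" "a \<in> U" "weyl_ultrafilter S E U"
    using ultrafilter_filter by (auto simp: weyl_basic_def)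
  obtain s where sU: "s \<in> U" "s \<lless> a" using filter_lower[OF U(1)] U(2) by blast
  obtain t where tU: "t \<in> U" "t \<lless> s" using filter_lower[OF U(1)] sU(1) by blast
  obtain b where b: "b \<in> U" "b \<lless> t" using filter_lower[OF U(1)] tU(1) by blast
  have S: "s \<in> S" "t \<in> S" "b \<in> S" using sU tU b filter_subset[OF U(1)] by blast+
  interpret plateau_family S E L s t using S tU by unfold_locales
  have "openin (weyl_groupoid S E) (weyl_basic S E b)"
    unfolding openin_weyl_groupoid using S by (intro exI[of _ "{b}"]) auto
  moreover have "U \<in> weyl_basic S E b" using U b by (simp add: weyl_basic_def)
  moreover have "core a \<subseteq> W" using a by (auto simp: core_def weyl_basic_def)
  ultimately show "\<exists>X K. openin (weyl_groupoid S E) X \<and> compactin (weyl_groupoid S E) K \<and>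
      U \<in> X \<and> X \<subseteq> K \<and> K \<subseteq> W"
    using compactin_core[OF a(1) sU(2)] weyl_basic_subset_core[OF S(3) b(2) a(1) sU(2)] by blast
qed

end

section \<open>The two positivity hypotheses\<close>

text \<open>By commutativity \<open>b\<^sup>* b c\<^sup>* c = (b c)\<^sup>* (b c)\<close>.\<close>

lemma Sigma_sums_mult:
  assumes "star_subsemigroup L" "commutative_on L" "x \<in> Sigma_sums L" "y \<in> Sigma_sums L"
  shows "x * y \<in> Sigma_sums (L :: 'a::star_ring set)"
proof -
  obtain ps qs where ps: "x = sum_list ps" "ps \<noteq> []" "set ps \<subseteq> squares L"
    and qs: "y = sum_list qs" "qs \<noteq> []" "set qs \<subseteq> squares L"
    using assms by (auto simp: Sigma_sums_def)
  have sq: "p * q \<in> Sigma_sums L" if pq: "p \<in> squares L" "q \<in> squares L" for p q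
  proof -
    obtain b c where b: "p = sq b" "b \<in> L" and c: "q = sq c" "c \<in> L"
      using pq by (auto simp: squares_def)
    have L_mult: "v * w \<in> L" if "v \<in> L" "w \<in> L" for v w
      using assms(1) that by (auto simp: star_subsemigroup_def set_prod_def)
    have "star b \<in> L" "star c \<in> L" using assms(1) b c by (auto simp: star_subsemigroup_def)
    then have L: "star c \<in> L" "b * c \<in> L" "sq b \<in> L" using b c L_mult by blast+
    have "p * q = (sq b * star c) * c" unfolding b c by (simp add: mult.assoc)
    also have "sq b * star c = star c * sq b" using assms(2) L by (auto simp: commutative_on_def)
    finally have "p * q = sq (b * c)" by (simp add: star_mult mult.assoc)
    then show ?thesis using Sigma_sums_sq[OF L(2)] by simp
  qed
  have row: "p * sum_list qs \<in> Sigma_sums L" if p: "p \<in> squares L" for p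
    using qs(2,3)
  proof (induction qs rule: list_nonempty_induct)
    case (cons q qs) then show ?case using sq[OF p] by (auto simp: distrib_left intro!: Sigma_sums_add)
  qed (use sq p in auto)
  show ?thesis unfolding ps(1) qs(1) using ps(2,3)
  proof (induction ps rule: list_nonempty_induct)
    case (cons p ps) then show ?case using row by (auto simp: distrib_right intro!: Sigma_sums_add)
  qed (use row in auto)
qed

lemma nat_quotient_mult:
  assumes "star_subsemigroup L" "commutative_on L"
    and "x \<in> nat_quotient (Sigma_sums L)" "y \<in> nat_quotient (Sigma_sums L)"
  shows "x * y \<in> nat_quotient (Sigma_sums (L :: 'a::star_ring set))"
proof -
  obtain m n where mn: "m > 0" "n > 0" "nmul m x \<in> Sigma_sums L" "nmul n y \<in> Sigma_sums L"
    using assms(3,4) by (auto simp: nat_quotient_def)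
  have "nmul (m * n) (x * y) = nmul m (x * nmul n y)"
    by (simp only: nmul_mult nmul_mult_right)
  also have "\<dots> = nmul m x * nmul n y" by (simp only: nmul_mult_left)
  finally have "nmul (m * n) (x * y) = nmul m x * nmul n y" .
  then have "nmul (m * n) (x * y) \<in> Sigma_sums L" using Sigma_sums_mult[OF assms(1,2) mn(3,4)] by simp
  then show ?thesis unfolding nat_quotient_def using mn by (intro CollectI exI[of _ "m * n"]) simp
qed

text \<open>A multiple of \<open>y\<close> is a sum of squares \<open>b\<^sup>* b\<close>, and \<open>b\<^sup>* b - d b\<^sup>* b = b\<^sup>* b - b\<^sup>* d b\<close>.\<close>

lemma sq_mult_le_nat_quotient:
  assumes arch: "star_archimedean TYPE('a::star_ring)"
    and d: "upper_bd d \<le> 1" "d \<in> L" and L: "commutative_on L" "star_subsemigroup L"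
    and y: "y \<in> nat_quotient (Sigma_sums (L :: 'a set))"
  shows "0 \<unlhd> y - d * y"
proof -
  obtain n where n: "n > 0" "nmul n y \<in> Sigma_sums L" using y by (auto simp: nat_quotient_def)
  then obtain ps where ps: "nmul n y = sum_list ps" "set ps \<subseteq> squares L" by (auto simp: Sigma_sums_def)
  have one: "0 \<unlhd> p - d * p" if p: "p \<in> squares L" for p
  proof -
    obtain b where b: "p = sq b" "b \<in> L" using p by (auto simp: squares_def)
    have "star b \<in> L" using L(2) b by (auto simp: star_subsemigroup_def)
    then have "star b * d = d * star b" using L(1) d(2) by (auto simp: commutative_on_def)
    then have "d * p = star b * d * b" by (simp add: b mult.assoc)
    then show ?thesis using sq_compression_le[OF arch d(1), of b] b by simp
  qed
  have "0 \<unlhd> sum_list ps - d * sum_list ps" using ps(2)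
  proof (induction ps)
    case (Cons p ps)
    have "sum_list (p # ps) - d * sum_list (p # ps) = (p - d * p) + (sum_list ps - d * sum_list ps)"
      by (simp add: algebra_simps)
    then show ?case using Cons one by (simp only: star_nonneg_add list.set insert_subset)
  qed (simp add: star_nonneg_0)
  then have "0 \<unlhd> nmul n (y - d * y)"
    by (simp add: ps(1)[symmetric] nmul_diff_right nmul_mult_right)
  then show ?thesis using n(1) star_nonneg_nmul_cancel by blast
qed

lemma star_one_self_adjoint:
  assumes "\<And>a. e * a = a \<and> a * e = (a::'a::star_ring)"
  shows "star e = e"
proof -
  have "star e = star e * e" using assms by simp
  also have "\<dots> = star (star e * e)" by (simp add: star_mult star_star)
  also have "\<dots> = e" using assms by (simp add: star_star)
  finally show ?thesis .
qed

text \<open>The product of two commuting self-adjoint elements is self-adjoint.\<close>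

lemma nonneg_commuting_mult:
  fixes x y :: "'a::star_ring"
  assumes inf: "infinitesimal_free TYPE('a)"
    and prod: "self_adjoint_part (set_prod (positive_part UNIV) (positive_part UNIV))
           \<subseteq> positive_part (UNIV :: 'a set)"
    and "0 \<unlhd> x" "0 \<unlhd> y" "x * y = y * x"
  shows "0 \<unlhd> x * y"
proof -
  have "star (x * y) = x * y"
    using assms star_nonneg_self_adjoint[OF inf] by (simp add: star_mult)
  then have "x * y \<in> self_adjoint_part (set_prod (positive_part UNIV) (positive_part UNIV))"
    unfolding self_adjoint_part_def set_prod_def positive_part_def using assms(3,4) by auto
  then show ?thesis using prod by (auto simp: positive_part_def)
qed

text \<open>In the presence of a unit \<open>e\<close>, the element \<open>(e - d) y\<close> is a product of commuting positive elements.\<close>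

lemma sq_mult_le_unital:
  fixes d y :: "'a::star_ring"
  assumes arch: "star_archimedean TYPE('a)" and inf: "infinitesimal_free TYPE('a)"
    and one: "unital TYPE('a)"
    and prod: "self_adjoint_part (set_prod (positive_part UNIV) (positive_part UNIV))
           \<subseteq> positive_part (UNIV :: 'a set)"
    and d: "upper_bd d \<le> 1" and y: "0 \<unlhd> y" "d * y = y * d"
  shows "0 \<unlhd> y - d * y"
proof -
  obtain e :: 'a where e: "\<And>a. e * a = a \<and> a * e = a" using one by (auto simp: unital_def)
  have "0 \<unlhd> e - d"
    using sq_compression_le[OF arch d, of e] star_one_self_adjoint[OF e] e by simp
  then have "0 \<unlhd> (e - d) * y"
    using y e by (intro nonneg_commuting_mult[OF inf prod]) (auto simp: algebra_simps)
  then show ?thesis using e by (simp add: algebra_simps)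
qed

theorem corollary3p31:
  fixes S E L :: "'a::star_ring set"
  assumes "star_archimedean TYPE('a)"
    and "infinitesimal_free TYPE('a)"
    and "star_proper TYPE('a)"
    and "weyl_star_semigroup S E"
    and "S \<subseteq> star_unit_ball"
    and "star_subring L" and "commutative_on L" and "hereditary S L"
    and "star_lattice L"
    and "positive_part L = nat_quotient (Sigma_sums L) \<or>
         unital TYPE('a) \<and>
         self_adjoint_part (set_prod (positive_part UNIV) (positive_part UNIV))
           \<subseteq> positive_part (UNIV :: 'a set)"
  shows "neighbourhood_base_of (compactin (weyl_groupoid S E)) (weyl_groupoid S E)"
proof (cases "S = {}")
  case True
  then have "weyl_groupoid S E = topology_generated_by {}" by (simp add: weyl_groupoid_def)
  then have "topspace (weyl_groupoid S E) = {}" by simp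
  then show ?thesis using openin_subset unfolding neighbourhood_base_of by fastforce
next
  case False
  then obtain r where r: "r \<in> S" by blast
  have semi: "star_subsemigroup L" and zero: "0 \<in> L" 
    using assms(6) by (auto simp: star_subring_def additive_subgroup_def)
  have LP: "x \<in> positive_part L \<longleftrightarrow> x \<in> L \<and> 0 \<unlhd> x" for x by (simp add: positive_part_def)
  have "0 \<unlhd> sq r" by (rule sq_nonneg)
  \<comment> \<open>Heredity applied to \<open>0 \<le> r\<^sup>* r\<close>.\<close>
  then have S0: "0 \<in> S"
    using assms(8) r zero star_nonneg_0 by (auto simp: hereditary_def LP)
  interpret lattice_ordered_subring L
  proof
    fix x y assume xy: "x \<in> L" "y \<in> L" "0 \<unlhd> x" "0 \<unlhd> y"
    from assms(10) show "0 \<unlhd> x * y"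
    proof
      assume pos: "positive_part L = nat_quotient (Sigma_sums L)"
      then show ?thesis
        using nat_quotient_mult[OF semi assms(7), of x y] xy LP by metis
    next
      assume "unital TYPE('a) \<and> self_adjoint_part (set_prod (positive_part UNIV) (positive_part UNIV))
           \<subseteq> positive_part (UNIV :: 'a set)"
      then show ?thesis
        using nonneg_commuting_mult[OF assms(2)] xy assms(7) by (auto simp: commutative_on_def)
    qed
  qed (fact assms)+
  interpret weyl_lattice S E L
  proof
    fix s assume s: "s \<in> S"
    have d: "upper_bd (sq s) \<le> 1" using assms(5) s upper_bd_sq_unit_ball by blast
    have dL: "sq s \<in> L" using assms(8) s by (auto simp: hereditary_def squares_def)
    have "0 \<unlhd> y - sq s * y" if y: "y \<in> L" "0 \<unlhd> y" for y
      using assms(10)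
    proof
      assume pos: "positive_part L = nat_quotient (Sigma_sums L)"
      then show ?thesis
        using sq_mult_le_nat_quotient[OF assms(1) d dL assms(7) semi] y LP by metis
    next
      assume "unital TYPE('a) \<and> self_adjoint_part (set_prod (positive_part UNIV) (positive_part UNIV))
           \<subseteq> positive_part (UNIV :: 'a set)"
      then show ?thesis
        using sq_mult_le_unital[OF assms(1,2) _ _ d y(2)] L_comm[OF dL y(1)] by blast
    qed
    then show "contraction (sq s)" using dL sq_nonneg by (simp add: contraction_def)
  qed (fact assms S0)+
  show ?thesis by (rule weyl_groupoid_locally_compact)
qed

end
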